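(* For each $c\ge 2$ and each $h\ge 0$, the KPP-Fisher delayed equation $$\frac{\partial u(t,x)}{\partial t}=\frac{\partial^2u(t,x)}{\partial x^2}+u(t,x)\bigl(1-u(t-h,x)\bigr)$$ has a unique (up to translation) semi-wavefront with speed $c$; that is, a semi-wavefront with speed $c$ exists, and if $\phi,\psi$ are profiles of two semi-wavefronts with speed $c$, then there is $t'\in\mathbb{R}$ such that $\phi(t+t')=\psi(t)$ for all $t\in\mathbb{R}$.
   Context: A semi-wavefront with speed $c$ is a classical solution of the form $u(t,x)=\phi(x+ct)$ whose profile $\phi$ is positive and bounded on $\mathbb{R}$ and satisfies $\phi(-\infty)=0$. Equivalently, $\phi$ is a $C^2$, positive, bounded function on $\mathbb{R}$ with $\phi(-\infty)=0$ and $\phi''(t)-c\phi'(t)+\phi(t)(1-\phi(t-ch))=0$ for all $t\in\mathbb{R}$. *)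

theory Defs
  imports "HOL-Analysis.Analysis"
begin

text \<open>
  Entire classical solutions of the delayed equation
  \<open>u\<^sub>t(t,x) = u\<^sub>x\<^sub>x(t,x) + u(t,x) (1 - u(t-h,x))\<close>:
  \<open>u\<close> is of class \<open>C\<^sup>1\<close> in \<open>t\<close> and \<open>C\<^sup>2\<close> in \<open>x\<close>, with partial derivatives jointly
  continuous on the whole plane.
\<close>

definition kpp_fisher_solution :: "real \<Rightarrow> (real \<Rightarrow> real \<Rightarrow> real) \<Rightarrow> bool" where
  "kpp_fisher_solution h u \<longleftrightarrow>
    (\<exists>ut ux uxx :: real \<Rightarrow> real \<Rightarrow> real.
      (\<forall>t x. ((\<lambda>s. u s x) has_real_derivative ut t x) (at t)) \<and>
      (\<forall>t x. ((\<lambda>y. u t y) has_real_derivative ux t x) (at x)) \<and>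
      (\<forall>t x. ((\<lambda>y. ux t y) has_real_derivative uxx t x) (at x)) \<and>
      continuous_on UNIV (\<lambda>(t, x). ut t x) \<and>
      continuous_on UNIV (\<lambda>(t, x). ux t x) \<and>
      continuous_on UNIV (\<lambda>(t, x). uxx t x) \<and>
      (\<forall>t x. ut t x = uxx t x + u t x * (1 - u (t - h) x)))"

text \<open>\<open>\<phi>\<close> is the profile of a semi-wavefront \<open>u(t,x) = \<phi>(x + c t)\<close> with speed \<open>c\<close>.\<close>

definition semi_wavefront_profile :: "real \<Rightarrow> real \<Rightarrow> (real \<Rightarrow> real) \<Rightarrow> bool" where
  "semi_wavefront_profile h c \<phi> \<longleftrightarrow>
    kpp_fisher_solution h (\<lambda>t x. \<phi> (x + c * t)) \<and>
    (\<forall>s. \<phi> s > 0) \<and> bounded (range \<phi>) \<and> (\<phi> \<longlongrightarrow> 0) at_bot"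

lemma kpp_fisher_solution_travelling_iff:
  "kpp_fisher_solution h (\<lambda>t x. \<phi> (x + c * t)) \<longleftrightarrow>
    (\<exists>\<phi>' \<phi>''.
      (\<forall>s. (\<phi> has_real_derivative \<phi>' s) (at s)) \<and>
      (\<forall>s. (\<phi>' has_real_derivative \<phi>'' s) (at s)) \<and>
      continuous_on UNIV \<phi>'' \<and>
      (\<forall>s. \<phi>'' s - c * \<phi>' s + \<phi> s * (1 - \<phi> (s - c * h)) = 0))"
  (is "?L \<longleftrightarrow> ?R")
proof
  assume ?L
  then obtain ut ux uxx :: "real \<Rightarrow> real \<Rightarrow> real" where
    t: "\<And>t x. ((\<lambda>s. \<phi> (x + c * s)) has_real_derivative ut t x) (at t)" and
    x: "\<And>t x. ((\<lambda>y. \<phi> (y + c * t)) has_real_derivative ux t x) (at x)" and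
    xx: "\<And>t x. ((\<lambda>y. ux t y) has_real_derivative uxx t x) (at x)" and
    cont: "continuous_on UNIV (\<lambda>(t, x). uxx t x)" and
    eq: "\<And>t x. ut t x = uxx t x + \<phi> (x + c * t) * (1 - \<phi> (x + c * (t - h)))"
    unfolding kpp_fisher_solution_def by blast
  have d: "(\<phi> has_real_derivative ux 0 s) (at s)" for s
    using x[of 0 s] by simp
  have ut: "ut 0 s = c * ux 0 s" for s
  proof -
    have "((\<lambda>r. \<phi> (s + c * r)) has_real_derivative ux 0 s * c) (at 0)"
      by (rule DERIV_chain2) (auto intro!: derivative_eq_intros simp: d)
    with t[of s 0] show ?thesis by (metis DERIV_unique mult.commute)
  qed
  have "continuous_on UNIV (\<lambda>s. uxx 0 s)"
    using continuous_on_compose2[OF cont, of UNIV "\<lambda>s. (0, s)"]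
    by (simp add: continuous_intros)
  moreover have "uxx 0 s - c * ux 0 s + \<phi> s * (1 - \<phi> (s - c * h)) = 0" for s
    using eq[of 0 s] ut[of s] by simp
  ultimately show ?R using d xx by blast
next
  assume ?R
  then obtain p q where
    p: "\<And>s. (\<phi> has_real_derivative p s) (at s)" and
    q: "\<And>s. (p has_real_derivative q s) (at s)" and
    cont: "continuous_on UNIV q" and
    eq: "\<And>s. q s - c * p s + \<phi> s * (1 - \<phi> (s - c * h)) = 0"
    by blast
  have contp: "continuous_on UNIV p"
    using q by (meson DERIV_isCont continuous_at_imp_continuous_on)
  have l: "continuous_on UNIV (\<lambda>z::real \<times> real. snd z + c * fst z)"
    by (intro continuous_intros)
  note cp = continuous_on_compose2[OF contp l, simplified]
  note cq = continuous_on_compose2[OF cont l, simplified]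
  have 1: "((\<lambda>s. \<phi> (x + c * s)) has_real_derivative c * p (x + c * t)) (at t)" for t x
  proof -
    have "((\<lambda>s. \<phi> (x + c * s)) has_real_derivative p (x + c * t) * c) (at t)"
      by (rule DERIV_chain2) (auto intro!: derivative_eq_intros p)
    then show ?thesis by (simp add: mult.commute)
  qed
  have 2: "((\<lambda>y. \<phi> (y + c * t)) has_real_derivative p (x + c * t)) (at x)" for t x
    using p[of "x + c * t"] by (simp only: DERIV_shift)
  have 3: "((\<lambda>y. p (y + c * t)) has_real_derivative q (x + c * t)) (at x)" for t x
    using q[of "x + c * t"] by (simp only: DERIV_shift)
  have 4: "c * p (x + c * t) = q (x + c * t) + \<phi> (x + c * t) * (1 - \<phi> (x + c * (t - h)))" for t x
    using eq[of "x + c * t"] by (simp add: algebra_simps)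
  show ?L unfolding kpp_fisher_solution_def
    by (rule exI[of _ "\<lambda>t x. c * p (x + c * t)"], rule exI[of _ "\<lambda>t x. p (x + c * t)"],
        rule exI[of _ "\<lambda>t x. q (x + c * t)"])
       (intro conjI allI 1 2 3 4; simp add: case_prod_unfold cp cq continuous_on_mult_left)
qed

end

theory Submission
  imports Defs "HOL-Complex_Analysis.Great_Picard" "HOL-Real_Asymp.Real_Asymp"
begin

text \<open>
  Write \<open>\<tau> = c h\<close> and let \<open>\<alpha> \<le> \<beta>\<close> be the roots of \<open>z\<^sup>2 - c z + 1\<close>.

  Uniqueness. For a profile \<open>\<phi>\<close>, the function \<open>H = e\<^sup>-\<^sup>\<alpha>\<^sup>t (\<beta> \<phi> - \<phi>')\<close> is decreasing, and positive since
  \<open>\<phi>\<close> would otherwise be unbounded; it has a finite limit at \<open>-\<infinity>\<close>, which translations rescale. If the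
  limits for \<open>\<phi>\<close> and \<open>\<psi>\<close> agree, then \<open>\<rho> = ln (\<phi> / \<psi>) \<rightarrow> 0\<close> at \<open>-\<infinity>\<close>. The weighted Wronskian
  \<open>V = e\<^sup>-\<^sup>c\<^sup>t (\<phi>' \<psi> - \<phi> \<psi>')\<close> satisfies \<open>V' = P (\<phi>(\<cdot> - \<tau>) - \<psi>(\<cdot> - \<tau>))\<close> and \<open>\<rho>' = V / P\<close> with
  \<open>P = e\<^sup>-\<^sup>c\<^sup>t \<phi> \<psi>\<close>. If \<open>V\<close> has constant sign near \<open>-\<infinity>\<close> without vanishing identically there, \<open>|V|\<close> stays
  bounded away from \<open>0\<close>, contradicting the boundedness of \<open>e\<^sup>c\<^sup>t V\<close>; if \<open>V\<close> changes sign arbitrarily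
  early, a contraction estimate gives \<open>\<rho> = 0\<close> near \<open>-\<infinity>\<close>.

  Existence. An explicit time discretisation started from a small constant is solved by shooting for a
  positive solution that grows at most like \<open>e\<^sup>\<beta>\<^sup>t\<close>. Such a solution is bounded uniformly in the step
  size and reaches \<open>1/2\<close>; translate this time to \<open>0\<close> and let the step size and the initial value
  tend to \<open>0\<close>.
\<close>

section \<open>Real functions\<close>

lemma deriv_le_diff:
  fixes f g :: "real \<Rightarrow> real"
  assumes "a \<le> b"
    and "\<And>x. a \<le> x \<Longrightarrow> x \<le> b \<Longrightarrow> (f has_real_derivative f' x) (at x)"
    and "\<And>x. a \<le> x \<Longrightarrow> x \<le> b \<Longrightarrow> (g has_real_derivative g' x) (at x)"
    and "\<And>x. a \<le> x \<Longrightarrow> x \<le> b \<Longrightarrow> f' x \<le> g' x"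
  shows "f b - f a \<le> g b - g a"
proof -
  have "(\<lambda>x. g x - f x) a \<le> (\<lambda>x. g x - f x) b"
  proof (rule DERIV_nonneg_imp_nondecreasing[OF assms(1)])
    fix x assume "a \<le> x" "x \<le> b"
    then show "\<exists>y. ((\<lambda>x. g x - f x) has_real_derivative y) (at x) \<and> y \<ge> 0"
      using assms(2-4)[of x] by (intro exI[of _ "g' x - f' x"]) (auto intro: DERIV_diff)
  qed
  then show ?thesis by simp
qed

lemma abs_deriv_le_diff:
  fixes f g :: "real \<Rightarrow> real"
  assumes "a \<le> b"
    and f: "\<And>x. a \<le> x \<Longrightarrow> x \<le> b \<Longrightarrow> (f has_real_derivative f' x) (at x)"
    and g: "\<And>x. a \<le> x \<Longrightarrow> x \<le> b \<Longrightarrow> (g has_real_derivative g' x) (at x)"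
    and le: "\<And>x. a \<le> x \<Longrightarrow> x \<le> b \<Longrightarrow> \<bar>f' x\<bar> \<le> g' x"
  shows "\<bar>f b - f a\<bar> \<le> g b - g a"
proof -
  have "f b - f a \<le> g b - g a"
    by (rule deriv_le_diff[OF assms(1) f g]) (use le in force)+
  moreover have "- f b - - f a \<le> g b - g a"
    by (rule deriv_le_diff[OF assms(1) DERIV_minus[OF f] g]) (use le in force)+
  ultimately show ?thesis by linarith
qed

lemma deriv_nonneg_mono:
  fixes f :: "real \<Rightarrow> real"
  assumes "a \<le> b" "\<And>x. a \<le> x \<Longrightarrow> x \<le> b \<Longrightarrow> (f has_real_derivative f' x) (at x)"
    "\<And>x. a \<le> x \<Longrightarrow> x \<le> b \<Longrightarrow> 0 \<le> f' x"
  shows "f a \<le> f b"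
  using deriv_le_diff[of a b "\<lambda>_. 0" "\<lambda>_. 0" f f'] assms by simp

lemma deriv_nonpos_antimono:
  fixes f :: "real \<Rightarrow> real"
  assumes "a \<le> b" "\<And>x. a \<le> x \<Longrightarrow> x \<le> b \<Longrightarrow> (f has_real_derivative f' x) (at x)"
    "\<And>x. a \<le> x \<Longrightarrow> x \<le> b \<Longrightarrow> f' x \<le> 0"
  shows "f b \<le> f a"
  using deriv_le_diff[of a b f f' "\<lambda>_. 0" "\<lambda>_. 0"] assms by simp

text \<open>For barrier arguments: the first contact is the infimum of the points of
  \<open>[a, b]\<close> where \<open>f\<close> is nonnegative.\<close>

lemma first_zero:
  fixes f :: "real \<Rightarrow> real"
  assumes cont: "\<And>x. isCont f x" and "f a < 0" "a \<le> b" "f b \<ge> 0"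
  obtains x where "a < x" "x \<le> b" "f x = 0" "\<And>y. a \<le> y \<Longrightarrow> y < x \<Longrightarrow> f y < 0"
proof -
  define S where "S = {x \<in> {a..b}. f x \<ge> 0}"
  have cf: "continuous_on UNIV f" using cont by (simp add: continuous_at_imp_continuous_on)
  have "S = {a..b} \<inter> {x. 0 \<le> f x}" unfolding S_def by auto
  then have "closed S" by (simp add: closed_Int closed_Collect_le cf)
  moreover have "b \<in> S" "bdd_below S" using assms unfolding S_def by auto
  ultimately have "Inf S \<in> S" using closed_contains_Inf by blast
  then have x: "a \<le> Inf S" "Inf S \<le> b" "f (Inf S) \<ge> 0" unfolding S_def by auto
  have less: "f y < 0" if "a \<le> y" "y < Inf S" for y
  proof (rule ccontr)
    assume "\<not> f y < 0"
    then have "y \<in> S" using that x unfolding S_def by auto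
    then show False using cInf_lower[OF _ \<open>bdd_below S\<close>] that by force
  qed
  have "f (Inf S) = 0"
  proof (rule ccontr)
    assume "f (Inf S) \<noteq> 0"
    then obtain z where "a \<le> z" "z \<le> Inf S" "f z = 0"
      using IVT[of f a 0 "Inf S"] assms x by auto
    then show False using less[of z] \<open>f (Inf S) \<noteq> 0\<close> by (cases "z = Inf S") auto
  qed
  moreover have "a < Inf S" using x assms(2) by (cases "a = Inf S") auto
  ultimately show thesis using that x less by blast
qed

lemma lhopital_at_bot:
  fixes f g :: "real \<Rightarrow> real"
  assumes g: "filterlim g at_top at_bot"
    and "\<And>x. (f has_real_derivative f' x) (at x)" "\<And>x. (g has_real_derivative g' x) (at x)"
    and "\<And>x. g' x \<noteq> 0"
    and l: "((\<lambda>x. f' x / g' x) \<longlongrightarrow> y) at_bot"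
  shows "((\<lambda>x. f x / g x) \<longlongrightarrow> y) at_bot"
proof -
  have *: "((\<lambda>x. F (-x)) has_real_derivative - F' (-x)) (at x)"
    if "\<And>x. (F has_real_derivative F' x) (at x)" for F F' :: "real \<Rightarrow> real" and x
    using DERIV_chain2[OF that DERIV_minus[OF DERIV_ident], of x] by simp
  have "((\<lambda>x. f (-x) / g (-x)) \<longlongrightarrow> y) at_top"
    by (rule lhospital_at_top_at_top[where g' = "\<lambda>x. - g' (-x)" and f' = "\<lambda>x. - f' (-x)"])
      (use assms * in \<open>auto simp: filterlim_at_bot_mirror intro!: always_eventually\<close>)
  then show ?thesis by (simp add: filterlim_at_bot_mirror)
qed

lemma deriv_le_at_bot:
  fixes f g :: "real \<Rightarrow> real"
  assumes "(f \<longlongrightarrow> 0) at_bot" "(g \<longlongrightarrow> 0) at_bot"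
    and "\<And>x. x \<le> t \<Longrightarrow> (f has_real_derivative f' x) (at x)"
    and "\<And>x. x \<le> t \<Longrightarrow> (g has_real_derivative g' x) (at x)"
    and "\<And>x. x \<le> t \<Longrightarrow> f' x \<le> g' x"
  shows "f t \<le> g t"
proof -
  have "f t - 0 \<le> g t - 0"
  proof (rule tendsto_le[OF trivial_limit_at_bot_linorder])
    show "((\<lambda>s. f t - f s) \<longlongrightarrow> f t - 0) at_bot" "((\<lambda>s. g t - g s) \<longlongrightarrow> g t - 0) at_bot"
      by (intro tendsto_diff tendsto_const assms)+
    show "\<forall>\<^sub>F s in at_bot. f t - f s \<le> g t - g s"
      unfolding eventually_at_bot_linorder
      by (intro exI[of _ t] allI impI deriv_le_diff[of _ t f f' g g'] assms) auto
  qed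
  then show ?thesis by simp
qed

lemma abs_deriv_le_at_bot:
  fixes f g :: "real \<Rightarrow> real"
  assumes f: "(f \<longlongrightarrow> 0) at_bot" and g: "(g \<longlongrightarrow> 0) at_bot"
    and f': "\<And>x. x \<le> t \<Longrightarrow> (f has_real_derivative f' x) (at x)"
    and g': "\<And>x. x \<le> t \<Longrightarrow> (g has_real_derivative g' x) (at x)"
    and le: "\<And>x. x \<le> t \<Longrightarrow> \<bar>f' x\<bar> \<le> g' x"
  shows "\<bar>f t\<bar> \<le> g t"
proof -
  have "f t \<le> g t" by (rule deriv_le_at_bot[OF f g f' g']) (use le in force)+
  moreover have "- f t \<le> g t"
  proof (rule deriv_le_at_bot[OF _ g DERIV_minus[OF f'] g'])
    show "((\<lambda>x. - f x) \<longlongrightarrow> 0) at_bot" using tendsto_minus[OF f] by simp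
  qed (use le in force)+
  ultimately show ?thesis by linarith
qed

lemma abs_exp_minus_one_le:
  fixes x :: real
  assumes "\<bar>x\<bar> \<le> 1"
  shows "\<bar>exp x - 1\<bar> \<le> 2 * \<bar>x\<bar>"
proof (cases "x \<ge> 0")
  case True
  then have "exp x \<le> 1 + x + x\<^sup>2" using assms by (intro exp_bound) auto
  moreover have "x * x \<le> 1 * x" using True assms by (intro mult_right_mono) auto
  ultimately show ?thesis using True by (simp add: power2_eq_square)
next
  case False
  then have "\<bar>exp x - 1\<bar> = 1 - exp x" "\<bar>x\<bar> = - x" by auto
  then show ?thesis using exp_ge_add_one_self[of x] False by linarith
qed

section \<open>Asymptotics of a profile\<close>

text \<open>The characteristic roots of \<open>\<phi>'' - c \<phi>' + \<phi> = 0\<close>, the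
  linearisation at 0; the delayed factor enters only at second order. For \<open>c \<ge> 2\<close>
  they are real, with a double root at \<open>c = 2\<close>.\<close>

definition lam1 :: "real \<Rightarrow> real" where "lam1 c = (c - sqrt (c\<^sup>2 - 4)) / 2"
definition lam2 :: "real \<Rightarrow> real" where "lam2 c = (c + sqrt (c\<^sup>2 - 4)) / 2"

lemma lam_props:
  assumes "c \<ge> 2"
  shows "lam1 c + lam2 c = c" "lam1 c * lam2 c = 1" "0 < lam1 c" "lam1 c \<le> lam2 c"
    "1 \<le> lam2 c"
proof -
  have "c\<^sup>2 \<ge> 2\<^sup>2" using assms by (intro power_mono) auto
  then have s: "(sqrt (c\<^sup>2 - 4))\<^sup>2 = c\<^sup>2 - 4" "sqrt (c\<^sup>2 - 4) \<ge> 0" by auto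
  show 1: "lam1 c + lam2 c = c" by (simp add: lam1_def lam2_def field_simps)
  have "lam1 c * lam2 c = (c\<^sup>2 - (sqrt (c\<^sup>2 - 4))\<^sup>2) / 4"
    by (simp add: lam1_def lam2_def power2_eq_square algebra_simps)
  then show 2: "lam1 c * lam2 c = 1" using s by simp
  show "lam1 c \<le> lam2 c" using s by (simp add: lam1_def lam2_def)
  have "1 \<le> (c + r) / 2" if "r \<ge> 0" for r using that assms by simp
  from this[OF s(2)] show "1 \<le> lam2 c" unfolding lam2_def .
  then show "0 < lam1 c" using 2
    by (metis less_le_trans zero_less_mult_pos2 zero_less_one)
qed

text \<open>The profile equation as a first-order system with \<open>p = \<phi>'\<close>. The bound
  \<open>B\<close> is a parameter so that two profiles can share it.\<close>

locale wave =
  fixes c \<tau> B :: real and \<phi> p :: "real \<Rightarrow> real"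
  assumes c2: "c \<ge> 2" and tau: "\<tau> \<ge> 0"
    and d_phi: "\<And>t. (\<phi> has_real_derivative p t) (at t)"
    and d_p: "\<And>t. (p has_real_derivative c * p t - \<phi> t * (1 - \<phi> (t - \<tau>))) (at t)"
    and pos: "\<And>t. 0 < \<phi> t" and bdd: "\<And>t. \<phi> t \<le> B"
    and lim0: "(\<phi> \<longlongrightarrow> 0) at_bot"
begin

abbreviation "\<alpha> \<equiv> lam1 c"
abbreviation "\<beta> \<equiv> lam2 c"

lemmas lam = lam_props[OF c2]

lemma B_pos: "0 < B" using pos[of 0] bdd[of 0] by simp

section \<open>Factorised equation and bounds on the derivative\<close>

definition H where "H t = exp (- \<alpha> * t) * (\<beta> * \<phi> t - p t)"

text \<open>The equation factors as \<open>(d/dt - \<alpha>) (d/dt - \<beta>) \<phi> = \<phi>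
  \<phi>(t - \<tau>)\<close>, and the weight \<open>exp (- \<alpha> t)\<close> turns the outer
  factor into a plain derivative.\<close>

lemma d_H: "(H has_real_derivative - (exp (- \<alpha> * t) * \<phi> t * \<phi> (t - \<tau>))) (at t)"
proof -
  have c: "c = \<alpha> + \<beta>" using lam by simp
  have "\<beta> * p t - (c * p t - \<phi> t * (1 - \<phi> (t - \<tau>))) - \<alpha> * (\<beta> * \<phi> t - p t)
      = - (\<phi> t * \<phi> (t - \<tau>)) + (1 - \<alpha> * \<beta>) * \<phi> t"
    by (subst (2) c) (simp add: algebra_simps)
  then have *: "\<beta> * p t - (c * p t - \<phi> t * (1 - \<phi> (t - \<tau>))) - \<alpha> * (\<beta> * \<phi> t - p t)
      = - (\<phi> t * \<phi> (t - \<tau>))" using lam(2) by simp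
  have "(H has_real_derivative exp (- \<alpha> * t) *
      (\<beta> * p t - (c * p t - \<phi> t * (1 - \<phi> (t - \<tau>))) - \<alpha> * (\<beta> * \<phi> t - p t))) (at t)"
    unfolding H_def [abs_def]
    by (rule derivative_eq_intros d_phi d_p refl)+ (simp add: algebra_simps)
  then show ?thesis unfolding * by (simp add: mult.assoc)
qed

lemma H_antimono: "s \<le> t \<Longrightarrow> H t \<le> H s"
  by (rule deriv_nonpos_antimono[OF _ d_H]) (auto simp: pos less_imp_le)

text \<open>Once nonpositive, \<open>H\<close> stays so. Then
  \<open>p \<ge> \<beta> \<phi> \<ge> \<phi>\<close> from there on, and \<open>\<phi>\<close> grows
  at least linearly, against its bound.\<close>

lemma H_pos: "0 < H t"
proof (rule ccontr)
  assume "\<not> 0 < H t"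
  then have le: "H s \<le> 0" if "s \<ge> t" for s using H_antimono[OF that] by linarith
  have p: "\<beta> * \<phi> s \<le> p s" if "s \<ge> t" for s
    using le[OF that] by (simp add: H_def mult_le_0_iff)
  \<comment> \<open>A slope of at least \<open>\<phi> t\<close> on \<open>[t, s]\<close> lifts
    \<open>\<phi>\<close> by \<open>B + 1\<close>.\<close>
  define s where "s = t + (B + 1) / \<phi> t"
  have ts: "t \<le> s" using B_pos pos[of t] by (simp add: s_def)
  have mono: "\<phi> t \<le> \<phi> x" if "x \<ge> t" for x
  proof (rule deriv_nonneg_mono[OF that d_phi])
    fix y assume "t \<le> y"
    then have "\<beta> * \<phi> y \<le> p y" "0 \<le> \<beta> * \<phi> y" using p lam pos[of y] by auto
    then show "0 \<le> p y" by linarith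
  qed
  have "\<phi> t * s - \<phi> t * t \<le> \<phi> s - \<phi> t"
  proof (rule deriv_le_diff[OF ts _ d_phi])
    fix x assume "t \<le> x"
    then have "\<phi> t \<le> \<phi> x" "\<beta> * \<phi> x \<le> p x" "1 * \<phi> x \<le> \<beta> * \<phi> x"
      using mono p lam pos[of x] by (auto intro: mult_right_mono)
    then show "\<phi> t \<le> p x" by linarith
  qed (auto intro!: derivative_eq_intros)
  moreover have "\<phi> t * (s - t) = B + 1" using pos[of t] by (simp add: s_def)
  then have "\<phi> t * s - \<phi> t * t = B + 1" by (simp add: right_diff_distrib)
  ultimately show False using bdd[of s] pos[of t] by linarith
qed

lemma p_less: "p t < \<beta> * \<phi> t"
  using H_pos[of t] by (simp add: H_def zero_less_mult_iff)

lemma p_upper: "p t \<le> \<beta> * B"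
  using p_less[of t] mult_left_mono[OF bdd[of t], of \<beta>] lam by linarith

text \<open>A derivative below \<open>- B\<^sup>2\<close> cannot recover:
  \<open>p' \<le> c p + B\<^sup>2\<close> pushes it further down, and \<open>\<phi>\<close> would
  become negative.\<close>

lemma p_lower: "- B\<^sup>2 \<le> p t"
proof (rule ccontr)
  assume n: "\<not> - B\<^sup>2 \<le> p t"
  have nB: "p t + B\<^sup>2 / c \<le> 0" "p t < 0"
  proof -
    have "B\<^sup>2 / c \<le> B\<^sup>2 / 1" by (rule divide_left_mono) (use c2 in auto)
    then show "p t + B\<^sup>2 / c \<le> 0" using n by simp
    show "p t < 0" using n zero_le_power2[of B] by linarith
  qed
  \<comment> \<open>\<open>- B\<^sup>2 / c\<close> is the equilibrium of the comparison equation
    \<open>p' = c p + B\<^sup>2\<close>.\<close>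
  define R where "R s = exp (- c * s) * (p s + B\<^sup>2 / c)" for s
  have dR: "(R has_real_derivative exp (- c * s) * (- \<phi> s * (1 - \<phi> (s - \<tau>)) - B\<^sup>2)) (at s)" for s
    unfolding R_def [abs_def] using c2
    by - ((rule derivative_eq_intros d_p refl)+, simp add: field_simps)
  have le: "p s \<le> p t" if "s \<ge> t" for s
  proof -
    have "R s \<le> R t"
    proof (rule deriv_nonpos_antimono[OF that dR])
      fix x
      have "\<phi> x * \<phi> (x - \<tau>) \<le> B * B" using bdd pos
        by (intro mult_mono) (auto simp: less_imp_le B_pos)
      then have "- \<phi> x * (1 - \<phi> (x - \<tau>)) - B\<^sup>2 \<le> 0"
        using pos[of x] by (simp add: power2_eq_square algebra_simps)
      then show "exp (- c * x) * (- \<phi> x * (1 - \<phi> (x - \<tau>)) - B\<^sup>2) \<le> 0"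
        by (intro mult_nonneg_nonpos) auto
    qed
    then have "exp (- c * s) * (p s + B\<^sup>2 / c) \<le> exp (- c * t) * (p t + B\<^sup>2 / c)" by (simp add: R_def)
    also have "\<dots> \<le> exp (- c * s) * (p t + B\<^sup>2 / c)"
      by (rule mult_right_mono_neg) (use nB that c2 in auto)
    finally show ?thesis by simp
  qed
  \<comment> \<open>The zero of the line through \<open>\<phi> t\<close> with slope
    \<open>p t\<close>.\<close>
  define s where "s = t + \<phi> t / - p t"
  have ts: "t \<le> s" using nB pos[of t] by (simp add: s_def divide_nonneg_neg)
  have "\<phi> s - \<phi> t \<le> p t * s - p t * t"
    by (rule deriv_le_diff[OF ts d_phi]) (auto intro!: derivative_eq_intros le)
  also have "\<dots> = - \<phi> t" using nB by (simp add: s_def field_simps)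
  finally show False using pos[of s] by linarith
qed

section \<open>Monotonicity and exponential decay near -\<infinity>\<close>

lemma phi_small: "e > 0 \<Longrightarrow> \<exists>T. \<forall>t\<le>T. \<phi> t < e"
  using order_tendstoD(2)[OF lim0, of e] by (simp add: eventually_at_bot_linorder)

text \<open>Vanishing at -\<infinity>, \<open>\<phi>\<close> cannot be nonincreasing on a whole left
  half-line, so \<open>p\<close> is positive somewhere. Where \<open>\<phi> < 1 / 2\<close>,
  \<open>exp (- c t) p\<close> decreases, which carries the positivity backwards.\<close>

lemma p_pos_near: "\<exists>T. \<forall>t\<le>T. 0 < p t \<and> \<phi> t < 1 / 2"
proof -
  obtain T where T: "\<And>t. t \<le> T \<Longrightarrow> \<phi> t < 1 / 2" using phi_small[of "1/2"] by auto
  have "\<exists>s\<le>T. 0 < p s"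
  proof (rule ccontr)
    assume n: "\<not> (\<exists>s\<le>T. 0 < p s)"
    obtain T' where T': "\<And>t. t \<le> T' \<Longrightarrow> \<phi> t < \<phi> T" using phi_small[OF pos[of T]] by auto
    have "\<phi> T \<le> \<phi> (min T T')"
      by (rule deriv_nonpos_antimono[OF _ d_phi]) (use n in \<open>auto simp: not_less\<close>)
    then show False using T'[of "min T T'"] by simp
  qed
  then obtain s where s: "s \<le> T" "0 < p s" by blast
  have "0 < p t" if "t \<le> s" for t
  proof -
    have "exp (- c * s) * p s \<le> exp (- c * t) * p t"
    proof (rule deriv_nonpos_antimono[OF that])
      fix x assume "t \<le> x" "x \<le> s"
      show "((\<lambda>x. exp (- c * x) * p x) has_real_derivative
          exp (- c * x) * - (\<phi> x * (1 - \<phi> (x - \<tau>)))) (at x)"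
        by (rule derivative_eq_intros d_p refl)+ (simp add: algebra_simps)
      have "\<phi> (x - \<tau>) < 1 / 2" using T[of "x - \<tau>"] \<open>x \<le> s\<close> s tau by auto
      then show "exp (- c * x) * - (\<phi> x * (1 - \<phi> (x - \<tau>))) \<le> 0"
        using pos[of x] by (simp add: mult_le_0_iff zero_le_mult_iff)
    qed
    moreover have "0 < exp (- c * s) * p s" using s by simp
    ultimately have "0 < exp (- c * t) * p t" by linarith
    then show ?thesis by (simp add: zero_less_mult_iff)
  qed
  then show ?thesis using T s by (intro exI[of _ s]) auto
qed

text \<open>\<open>J = c \<phi> - \<phi>'\<close> satisfies \<open>J' = \<phi> (1 - \<phi>(\<cdot> - \<tau>)) \<ge> J / (2 c)\<close> near \<open>-\<infinity>\<close> and dominates \<open>\<phi>\<close>.\<close>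

lemma decay: "\<exists>C k T. C > 0 \<and> k > 0 \<and> (\<forall>t\<le>T. \<phi> t \<le> C * exp (k * t))"
proof -
  obtain T where T: "\<And>t. t \<le> T \<Longrightarrow> 0 < p t \<and> \<phi> t < 1 / 2" using p_pos_near by auto
  define k where "k = 1 / (2 * c)"
  have k: "k > 0" using c2 by (simp add: k_def)
  define J where "J t = c * \<phi> t - p t" for t
  have J1: "\<alpha> * \<phi> t \<le> J t" for t
  proof -
    have "c * \<phi> t = \<alpha> * \<phi> t + \<beta> * \<phi> t" by (simp flip: distrib_right add: lam(1))
    then show ?thesis using p_less[of t] by (simp add: J_def)
  qed
  have J2: "exp (- k * t) * J t \<le> exp (- k * T) * J T" if "t \<le> T" for t
  proof (rule deriv_nonneg_mono[OF that])
    fix x assume x: "t \<le> x" "x \<le> T"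
    show "((\<lambda>x. exp (- k * x) * J x) has_real_derivative
        exp (- k * x) * (\<phi> x * (1 - \<phi> (x - \<tau>)) - k * J x)) (at x)"
      unfolding J_def
      by (rule derivative_eq_intros d_p d_phi refl)+ (simp add: algebra_simps)
    have "\<phi> (x - \<tau>) < 1 / 2" using T[of "x - \<tau>"] x tau by auto
    then have "\<phi> x * (1 / 2) \<le> \<phi> x * (1 - \<phi> (x - \<tau>))"
      using pos[of x] by (intro mult_left_mono) auto
    moreover have "k * J x \<le> k * (c * \<phi> x)" using T[of x] x k by (simp add: J_def)
    moreover have "k * (c * \<phi> x) = \<phi> x * (1 / 2)" using c2 by (simp add: k_def)
    ultimately show "0 \<le> exp (- k * x) * (\<phi> x * (1 - \<phi> (x - \<tau>)) - k * J x)" by simp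
  qed
  define C where "C = exp (- k * T) * J T / \<alpha>"
  have "J T > 0" using J1[of T] lam(3) pos[of T] by (meson less_le_trans mult_pos_pos)
  then have "C > 0" using lam by (simp add: C_def)
  moreover have "\<phi> t \<le> C * exp (k * t)" if "t \<le> T" for t
  proof -
    have "\<phi> t \<le> J t / \<alpha>" using J1[of t] lam by (simp add: field_simps)
    also have "J t = exp (k * t) * (exp (- k * t) * J t)" by (simp add: exp_minus)
    also have "\<dots> / \<alpha> \<le> exp (k * t) * (exp (- k * T) * J T) / \<alpha>"
      using J2[OF that] lam by (intro divide_right_mono mult_left_mono) auto
    finally show ?thesis by (simp add: C_def mult_ac)
  qed
  ultimately show ?thesis using k by blast
qed

text \<open>Half of the exponential rate pays for the quadratic weight; only \<open>T\<close>
  depends on \<open>A\<close>.\<close>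

lemma decay_sq:
  "\<exists>C k. C > 0 \<and> k > 0 \<and> (\<forall>A. \<exists>T. \<forall>t\<le>T. A - t \<ge> 1 \<and> (A - t)\<^sup>2 * \<phi> (t - \<tau>) \<le> C * exp (k * t))"
proof -
  obtain C k T where C: "C > 0" "k > 0" "\<And>t. t \<le> T \<Longrightarrow> \<phi> t \<le> C * exp (k * t)"
    using decay by blast
  have "\<exists>T. \<forall>t\<le>T. A - t \<ge> 1 \<and> (A - t)\<^sup>2 * \<phi> (t - \<tau>) \<le> C * exp (k / 2 * t)" for A
  proof -
    have "((\<lambda>t. (A - t)\<^sup>2 * exp (k / 2 * t)) \<longlongrightarrow> 0) at_bot" using \<open>k > 0\<close> by real_asymp
    from order_tendstoD(2)[OF this, of 1] obtain T2
      where T2: "\<And>t. t \<le> T2 \<Longrightarrow> (A - t)\<^sup>2 * exp (k / 2 * t) < 1"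
      by (auto simp: eventually_at_bot_linorder)
    have "(A - t)\<^sup>2 * \<phi> (t - \<tau>) \<le> C * exp (k / 2 * t)" if t: "t \<le> T" "t \<le> T2" for t
    proof -
      have "\<phi> (t - \<tau>) \<le> C * exp (k * (t - \<tau>))" using C(3)[of "t - \<tau>"] t tau by simp
      also have "\<dots> \<le> C * exp (k * t)" using C tau by simp
      also have "\<dots> = C * (exp (k / 2 * t) * exp (k / 2 * t))" by (simp flip: exp_add)
      finally have "(A - t)\<^sup>2 * \<phi> (t - \<tau>) \<le> (A - t)\<^sup>2 * (C * (exp (k / 2 * t) * exp (k / 2 * t)))"
        by (rule mult_left_mono) simp
      also have "\<dots> = C * exp (k / 2 * t) * ((A - t)\<^sup>2 * exp (k / 2 * t))" by simp
      also have "\<dots> \<le> C * exp (k / 2 * t) * 1"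
        using T2[OF t(2)] C by (intro mult_left_mono) auto
      finally show ?thesis by simp
    qed
    then show ?thesis by (intro exI[of _ "min (A - 1) (min T T2)"]) auto
  qed
  then show ?thesis using C by (intro exI[of _ C] exI[of _ "k / 2"]) auto
qed

section \<open>Leading asymptotics at -\<infinity>\<close>

abbreviation "\<mu> \<equiv> \<beta> - \<alpha>"

text \<open>The integrating factor for \<open>p - \<beta> \<phi>\<close>: integrating
  \<open>v'\<close> recovers \<open>\<phi>\<close> from \<open>H\<close>.\<close>

definition v where "v t = exp (- \<beta> * t) * \<phi> t"

lemma d_v: "(v has_real_derivative - (exp (- \<mu> * t) * H t)) (at t)"
  unfolding v_def [abs_def] H_def
  by (rule derivative_eq_intros d_phi refl)+ (simp add: algebra_simps flip: exp_add)

text \<open>Integrate \<open>v'\<close> from \<open>t\<close> to 0, where both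
  \<open>exp (- \<mu> x)\<close> and \<open>H x\<close> are largest at \<open>t\<close>. The
  constant \<open>v 0\<close> is absorbed into \<open>H t \<ge> H 0\<close>. The factor
  \<open>A - t\<close> makes the bound valid even for \<open>\<mu> = 0\<close>.\<close>

lemma phi_le: "\<exists>A. \<forall>t\<le>0. exp (- \<alpha> * t) * \<phi> t \<le> H t * (A - t)"
proof (intro exI allI impI)
  fix t :: real assume t: "t \<le> 0"
  let ?K = "exp (- \<mu> * t) * H t"
  have "- ?K * 0 - - ?K * t \<le> v 0 - v t"
  proof (rule deriv_le_diff[OF t _ d_v])
    fix x assume x: "t \<le> x"
    have "exp (- \<mu> * x) * H x \<le> exp (- \<mu> * t) * H t"
      using H_antimono[OF x] H_pos[of x] mult_left_mono_neg[OF x, of "- \<mu>"] lam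
      by (intro mult_mono) auto
    then show "- ?K \<le> - (exp (- \<mu> * x) * H x)" by simp
  qed (auto intro!: derivative_eq_intros)
  then have "v t \<le> v 0 + ?K * (0 - t)" by simp
  then have "exp (\<mu> * t) * v t \<le> exp (\<mu> * t) * (v 0 + ?K * (0 - t))" by simp
  also have "exp (\<mu> * t) * v t = exp (- \<alpha> * t) * \<phi> t"
    by (simp add: v_def algebra_simps flip: exp_add)
  also have "exp (\<mu> * t) * (v 0 + ?K * (0 - t)) = exp (\<mu> * t) * v 0 + exp (\<mu> * t) * exp (- \<mu> * t) * H t * (0 - t)"
    by (simp only: distrib_left mult.assoc)
  also have "exp (\<mu> * t) * exp (- \<mu> * t) = 1" using exp_minus_inverse[of "\<mu> * t"] by (simp only: mult_minus_left)
  also have "exp (\<mu> * t) * v 0 \<le> 1 * v 0"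
    using t lam pos by (intro mult_right_mono) (auto simp: v_def mult_nonneg_nonpos less_imp_le)
  also have "v 0 = v 0 / H 0 * H 0" using H_pos[of 0] by simp
  also have "\<dots> \<le> v 0 / H 0 * H t"
    using t H_antimono[of t 0] H_pos[of 0] pos by (intro mult_left_mono) (auto simp: v_def less_imp_le)
  finally show "exp (- \<alpha> * t) * \<phi> t \<le> H t * (v 0 / H 0 - t)" by (simp add: algebra_simps)
qed

text \<open>Gronwall backwards in time: \<open>phi_le\<close> and the decay give
  \<open>H' \<ge> - C exp (k t) H\<close>, whose coefficient is integrable at -\<infinity>. Hence
  \<open>F\<close>, which is at least \<open>H\<close>, is nondecreasing far to the left.\<close>

lemma H_bounded: "\<exists>M. \<forall>t. H t \<le> M"
proof -
  obtain A where A: "\<And>t. t \<le> 0 \<Longrightarrow> exp (- \<alpha> * t) * \<phi> t \<le> H t * (A - t)" using phi_le by blast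
  obtain C k T where C: "C > 0" "k > 0"
    "\<And>t. t \<le> T \<Longrightarrow> A - t \<ge> 1 \<and> (A - t)\<^sup>2 * \<phi> (t - \<tau>) \<le> C * exp (k * t)"
    using decay_sq by metis
  define F where "F t = H t * exp (C / k * exp (k * t))" for t
  define S where "S = min T 0"
  have F: "F t \<le> F S" if "t \<le> S" for t
  proof (rule deriv_nonneg_mono[OF that])
    fix x assume x: "t \<le> x" "x \<le> S"
    show "(F has_real_derivative exp (C / k * exp (k * x)) *
      (H x * (C * exp (k * x)) - exp (- \<alpha> * x) * \<phi> x * \<phi> (x - \<tau>))) (at x)"
      unfolding F_def [abs_def] using \<open>k > 0\<close>
      by - ((rule derivative_eq_intros d_H refl)+, simp add: field_simps)
    have a: "A - x \<ge> 1" "(A - x)\<^sup>2 * \<phi> (x - \<tau>) \<le> C * exp (k * x)" using C(3)[of x] x S_def by auto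
    have "(A - x) * 1 \<le> (A - x) * (A - x)" using a by (intro mult_left_mono) auto
    then have "(A - x) * \<phi> (x - \<tau>) \<le> (A - x)\<^sup>2 * \<phi> (x - \<tau>)"
      using pos[of "x - \<tau>"] by (intro mult_right_mono) (auto simp: power2_eq_square)
    with a have a2: "(A - x) * \<phi> (x - \<tau>) \<le> C * exp (k * x)" by linarith
    have "exp (- \<alpha> * x) * \<phi> x * \<phi> (x - \<tau>) \<le> H x * (A - x) * \<phi> (x - \<tau>)"
      using A[of x] x pos[of "x - \<tau>"] by (intro mult_right_mono) (auto simp: S_def)
    also have "\<dots> \<le> H x * (C * exp (k * x))"
      using a2 H_pos[of x] by (simp add: mult.assoc)
    finally show "0 \<le> exp (C / k * exp (k * x)) *
      (H x * (C * exp (k * x)) - exp (- \<alpha> * x) * \<phi> x * \<phi> (x - \<tau>))" by simp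
  qed
  have F': "H t \<le> F S" if "t \<le> S" for t
  proof -
    have "H t * 1 \<le> F t" unfolding F_def using H_pos[of t] C by (intro mult_left_mono) auto
    then show ?thesis using F[OF that] by simp
  qed
  have "H t \<le> F S" for t
    using F'[of t] F'[of S] H_antimono[of S t] by (cases "t \<le> S") auto
  then show ?thesis by blast
qed

lemma H_lim: "\<exists>a>0. (H \<longlongrightarrow> a) at_bot"
proof -
  obtain M where M: "\<And>t. H t \<le> M" using H_bounded by blast
  have bdd: "bdd_above (range H)" by (rule bdd_aboveI2[OF M])
  let ?a = "SUP t. H t"
  have le: "H t \<le> ?a" for t by (rule cSUP_upper[OF UNIV_I bdd])
  have "(H \<longlongrightarrow> ?a) at_bot"
  proof (rule order_tendstoI)
    fix y assume "y < ?a"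
    then obtain s where "y < H s" using less_cSUP_iff[OF _ bdd, of y] by auto
    then show "\<forall>\<^sub>F t in at_bot. y < H t" unfolding eventually_at_bot_linorder
      using H_antimono[of _ s] by (meson less_le_trans)
  next
    fix y assume "?a < y"
    then show "\<forall>\<^sub>F t in at_bot. H t < y" by (intro always_eventually allI le_less_trans[OF le])
  qed
  then show ?thesis using le[of 0] H_pos[of 0] by (intro exI[of _ ?a]) auto
qed

text \<open>For L'Hopital: on the left half-line \<open>v' \<le> - H 0 < 0\<close>, so
  \<open>v\<close> grows at least linearly towards -\<infinity>.\<close>

lemma v_at_top: "filterlim v at_top at_bot"
proof (rule filterlim_at_top_mono)
  have "filterlim (\<lambda>t. a + b * (- t)) at_top at_bot" if "b > 0" for a b :: real
    using that by real_asymp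
  from this[OF H_pos] show "filterlim (\<lambda>t. v 0 + H 0 * (- t)) at_top at_bot" .
  have "v 0 + H 0 * (- t) \<le> v t" if t: "t \<le> 0" for t
  proof -
    have "v 0 - v t \<le> - H 0 * 0 - - H 0 * t"
    proof (rule deriv_le_diff[OF t d_v])
      fix x :: real assume x: "x \<le> 0"
      have "1 * H 0 \<le> exp (- \<mu> * x) * H x"
        using H_antimono[OF x] H_pos[of 0] mult_nonpos_nonpos[of "- \<mu>" x] x lam
        by (intro mult_mono) auto
      then show "- (exp (- \<mu> * x) * H x) \<le> - H 0" by simp
    qed (auto intro!: derivative_eq_intros)
    then show ?thesis by simp
  qed
  then show "\<forall>\<^sub>F t in at_bot. v 0 + H 0 * (- t) \<le> v t"
    unfolding eventually_at_bot_linorder by blast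
qed

text \<open>The gap \<open>1 / (A - t)\<close> is what makes \<open>P / (A - t)\<^sup>2\<close>
  nonincreasing in the uniqueness proof. For \<open>c = 2\<close> it is \<open>phi_le\<close>
  rewritten; for \<open>c > 2\<close>, \<open>p / \<phi>\<close> tends to
  \<open>\<alpha> < c / 2\<close>, which leaves room for it.\<close>

lemma p_le_near: "\<exists>A T. T + 1 \<le> A \<and> (\<forall>t\<le>T. p t \<le> (c / 2 - 1 / (A - t)) * \<phi> t)"
proof (cases "c = 2")
  case True
  then have "\<beta> = 1" "\<alpha> = 1" by (auto simp: lam1_def lam2_def)
  obtain A where A: "\<And>t. t \<le> 0 \<Longrightarrow> exp (- \<alpha> * t) * \<phi> t \<le> H t * (A - t)" using phi_le by blast
  have "p t \<le> (c / 2 - 1 / (A - t)) * \<phi> t" if t: "t \<le> min 0 (A - 1)" for t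
  proof -
    have "exp (- \<alpha> * t) * \<phi> t \<le> exp (- \<alpha> * t) * ((\<phi> t - p t) * (A - t))"
      using A[of t] t \<open>\<beta> = 1\<close> by (simp add: H_def mult.assoc)
    then have "\<phi> t \<le> (\<phi> t - p t) * (A - t)" by simp
    then have "\<phi> t / (A - t) \<le> \<phi> t - p t" using t by (simp add: pos_divide_le_eq)
    then show ?thesis using True by (simp add: left_diff_distrib)
  qed
  then show ?thesis by (intro exI[of _ A] exI[of _ "min 0 (A - 1)"]) auto
next
  case False
  then have "0 < sqrt (c\<^sup>2 - 4)" using c2 power_strict_mono[of 2 c 2] by simp
  then have \<mu>: "\<mu> > 0" by (simp add: lam1_def lam2_def field_simps)
  obtain a where a: "a > 0" "(H \<longlongrightarrow> a) at_bot" using H_lim by blast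
  have top: "filterlim (\<lambda>t. exp (- \<mu> * t)) at_top at_bot"
  proof -
    have "filterlim (\<lambda>t. exp (- m * t)) at_top at_bot" if "m > 0" for m :: real
      using that by real_asymp
    from this[OF \<mu>] show ?thesis .
  qed
  have v: "((\<lambda>t. v t / exp (- \<mu> * t)) \<longlongrightarrow> a / \<mu>) at_bot"
  proof (rule lhopital_at_bot[OF top d_v])
    fix t show "((\<lambda>t. exp (- \<mu> * t)) has_real_derivative exp (- \<mu> * t) * (- \<mu>)) (at t)"
      by (rule derivative_eq_intros refl)+ simp
    show "exp (- \<mu> * t) * (- \<mu>) \<noteq> 0" using \<mu> by simp
  next
    have "(\<lambda>t. - (exp (- \<mu> * t) * H t) / (exp (- \<mu> * t) * (- \<mu>))) = (\<lambda>t. H t / \<mu>)"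
      using \<mu> by (auto simp: field_simps)
    then show "((\<lambda>t. - (exp (- \<mu> * t) * H t) / (exp (- \<mu> * t) * (- \<mu>))) \<longlongrightarrow> a / \<mu>) at_bot"
      using tendsto_divide[OF a(2) tendsto_const] \<mu> by simp
  qed
  \<comment> \<open>The denominator is \<open>exp (- \<alpha> t) \<phi> t\<close>, so this quotient
    is \<open>\<beta> - p / \<phi>\<close>.\<close>
  have "((\<lambda>t. H t / (v t / exp (- \<mu> * t))) \<longlongrightarrow> a / (a / \<mu>)) at_bot"
    by (rule tendsto_divide[OF a(2) v]) (use a \<mu> in auto)
  moreover have "H t / (v t / exp (- \<mu> * t)) = \<beta> - p t / \<phi> t" for t
  proof -
    have "exp (- \<beta> * t) = exp (- \<alpha> * t) * exp (- \<mu> * t)" by (simp add: algebra_simps flip: exp_add)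
    then have "v t / exp (- \<mu> * t) = exp (- \<alpha> * t) * \<phi> t" by (simp add: v_def)
    then show ?thesis using pos[of t] by (simp add: H_def diff_divide_distrib)
  qed
  ultimately have l: "((\<lambda>t. \<beta> - p t / \<phi> t) \<longlongrightarrow> \<mu>) at_bot" using a by simp
  have "((\<lambda>t::real. 1 / (0 - t)) \<longlongrightarrow> 0) at_bot" by real_asymp
  from tendsto_diff[OF l this]
  have "((\<lambda>t. \<beta> - p t / \<phi> t - 1 / (0 - t)) \<longlongrightarrow> \<mu> - 0) at_bot" .
  moreover have "\<beta> - c / 2 < \<mu> - 0" using \<mu> lam(1) by simp
  ultimately have "\<forall>\<^sub>F t in at_bot. \<beta> - c / 2 < \<beta> - p t / \<phi> t - 1 / (0 - t)"
    by (rule order_tendstoD)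
  then obtain T where T: "\<And>t. t \<le> T \<Longrightarrow> p t / \<phi> t < c / 2 - 1 / (0 - t)"
    by (force simp: eventually_at_bot_linorder)
  have "p t \<le> (c / 2 - 1 / (0 - t)) * \<phi> t" if "t \<le> T" for t
    using T[OF that] pos[of t] by (simp only: pos_divide_less_eq less_imp_le)
  then show ?thesis by (intro exI[of _ 0] exI[of _ "min T (-1)"]) auto
qed

lemma weaken: "B \<le> B' \<Longrightarrow> wave c \<tau> B' \<phi> p"
  using order.trans[OF bdd] c2 tau d_phi d_p pos lim0 by unfold_locales auto

lemma shift: "wave c \<tau> B (\<lambda>t. \<phi> (t + s)) (\<lambda>t. p (t + s))"
proof
  fix t
  have eq: "t + s - \<tau> = t - \<tau> + s" by simp
  show "((\<lambda>t. \<phi> (t + s)) has_real_derivative p (t + s)) (at t)"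
    using d_phi[of "t + s"] by (simp add: DERIV_shift)
  show "((\<lambda>t. p (t + s)) has_real_derivative
      c * p (t + s) - \<phi> (t + s) * (1 - \<phi> (t - \<tau> + s))) (at t)"
    using d_p[of "t + s"] by (simp only: DERIV_shift eq)
  show "((\<lambda>t. \<phi> (t + s)) \<longlongrightarrow> 0) at_bot"
    by (rule filterlim_compose[OF lim0]) real_asymp
qed (use c2 tau pos bdd in auto)

end

section \<open>Uniqueness\<close>

locale two_waves = W: wave c \<tau> B \<phi> p + X: wave c \<tau> B \<psi> r
  for c \<tau> B \<phi> p \<psi> r
begin

text \<open>Gronwall for the squared distance \<open>S\<close> of the phase points: a first contact
  of \<open>S\<close> with the barrier \<open>\<epsilon> exp (L (s - R))\<close> is impossible,
  since there \<open>S' < L S\<close>.\<close>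

lemma eq_forward:
  assumes eq: "\<And>t. t \<le> T \<Longrightarrow> \<phi> t = \<psi> t"
  shows "\<phi> t = \<psi> t"
proof (rule ccontr)
  assume neq: "\<phi> t \<noteq> \<psi> t"
  define d where "d s = \<phi> s - \<psi> s" for s
  define e where "e s = p s - r s" for s
  define S where "S s = (d s)\<^sup>2 + (e s)\<^sup>2" for s
  \<comment> \<open>One more than the bound \<open>2 + 2 c + 3 B\<close> for \<open>S' / S\<close>
    at the contact, to get a strict inequality.\<close>
  define L where "L = 3 + 2 * c + 3 * B"
  \<comment> \<open>Strictly before \<open>T\<close> the profiles agree on a neighbourhood, so the
    derivatives agree too.\<close>
  define R where "R = T - 1"
  \<comment> \<open>Makes \<open>f t = 0\<close>, so a contact occurs by time
    \<open>t\<close>.\<close>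
  define \<epsilon> where "\<epsilon> = S t / exp (L * (t - R))"
  define f where "f s = S s - \<epsilon> * exp (L * (s - R))" for s
  define S' where "S' s = 2 * d s * e s
      + 2 * e s * (c * e s - d s * (1 - \<phi> (s - \<tau>)) + \<psi> s * d (s - \<tau>))" for s
  have d_d: "(d has_real_derivative e s) (at s)" for s
    unfolding d_def [abs_def] e_def by (intro DERIV_diff W.d_phi X.d_phi)
  have d_e: "(e has_real_derivative c * e s - d s * (1 - \<phi> (s - \<tau>)) + \<psi> s * d (s - \<tau>)) (at s)" for s
    unfolding e_def [abs_def] d_def
    by (rule derivative_eq_intros W.d_p X.d_p refl)+ (simp add: algebra_simps)
  have d_S: "(S has_real_derivative S' s) (at s)" for s
    unfolding S_def [abs_def] S'_def
    by (rule derivative_eq_intros d_e d_d refl)+ (simp add: algebra_simps)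
  have d_f: "(f has_real_derivative S' s - L * (\<epsilon> * exp (L * (s - R)))) (at s)" for s
    unfolding f_def [abs_def]
    by (rule derivative_eq_intros d_S refl)+ simp
  have S0: "S s \<ge> 0" for s by (simp add: S_def)
  have "S t > 0" using neq by (simp add: S_def d_def sum_power2_gt_zero_iff)
  then have "\<epsilon> > 0" by (simp add: \<epsilon>_def)
  have d0: "d s = 0" if "s \<le> R" for s using eq[of s] that by (simp add: d_def R_def)
  have "e R = 0"
    by (rule DERIV_local_const[OF d_d, of 1]) (use eq in \<open>auto simp: d_def R_def\<close>)
  have "R \<le> t" using eq[of t] neq by (auto simp: R_def intro: ccontr)
  have "S R = 0" using d0[of R] \<open>e R = 0\<close> by (simp add: S_def)
  then have "f R < 0" using \<open>\<epsilon> > 0\<close> by (simp add: f_def)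
  have "f t \<ge> 0" by (simp add: f_def \<epsilon>_def)
  obtain x where x: "R < x" "f x = 0" "\<And>y. R \<le> y \<Longrightarrow> y < x \<Longrightarrow> f y < 0"
    using first_zero[of f R t] DERIV_isCont[OF d_f] \<open>f R < 0\<close> \<open>R \<le> t\<close> \<open>f t \<ge> 0\<close> by metis
  have Sx: "S x = \<epsilon> * exp (L * (x - R))" using x by (simp add: f_def)
  have "L > 0" using W.B_pos W.c2 by (simp add: L_def)
  \<comment> \<open>At time \<open>x - \<tau>\<close> the difference is still zero, or there is no
    delay, or \<open>S\<close> lies below the increasing barrier.\<close>
  have tau_le: "(d (x - \<tau>))\<^sup>2 \<le> S x"
  proof -
    consider "x - \<tau> \<le> R" | "\<tau> = 0" | "R \<le> x - \<tau>" "x - \<tau> < x" using W.tau by linarith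
    then show ?thesis
    proof cases
      case 3
      then have "(d (x - \<tau>))\<^sup>2 \<le> \<epsilon> * exp (L * (x - \<tau> - R))"
        using x(3)[OF 3] zero_le_power2[of "e (x - \<tau>)"] unfolding f_def S_def by linarith
      also have "\<dots> \<le> \<epsilon> * exp (L * (x - R))" using \<open>\<epsilon> > 0\<close> \<open>L > 0\<close> W.tau by simp
      finally show ?thesis using Sx by simp
    qed (use d0 S0 in \<open>auto simp: S_def\<close>)
  qed
  have "S' x \<le> (2 + 2 * c + 3 * B) * S x"
  proof -
    have y: "2 * (a * b) \<le> a\<^sup>2 + b\<^sup>2" "- (a\<^sup>2 + b\<^sup>2) \<le> 2 * (a * b)" for a b :: real
      using zero_le_power2[of "a - b"] zero_le_power2[of "a + b"]
      by (auto simp: power2_eq_square algebra_simps)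
    have 1: "2 * d x * e x \<le> S x" using y(1)[of "d x" "e x"] by (simp add: S_def)
    have 2: "2 * c * (e x)\<^sup>2 \<le> 2 * c * S x" using W.c2 by (intro mult_left_mono) (auto simp: S_def)
    have 3: "- (2 * (d x * e x)) \<le> S x" using y(2)[of "d x" "e x"] by (simp add: S_def)
    have 4: "2 * (d x * e x) * \<phi> (x - \<tau>) \<le> S x * B"
      using y(1)[of "d x" "e x"] W.pos[of "x - \<tau>"] W.bdd[of "x - \<tau>"]
      by (intro mult_mono) (auto simp: S_def)
    have 5: "2 * (e x * d (x - \<tau>)) * \<psi> x \<le> (S x + S x) * B"
    proof (intro mult_mono)
      show "2 * (e x * d (x - \<tau>)) \<le> S x + S x"
        using y(1)[of "e x" "d (x - \<tau>)"] tau_le zero_le_power2[of "d x"] unfolding S_def by linarith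
    qed (use X.pos[of x] X.bdd[of x] S0[of x] in auto)
    have "S' x = 2 * d x * e x + 2 * c * (e x)\<^sup>2 + - (2 * (d x * e x)) + 2 * (d x * e x) * \<phi> (x - \<tau>)
        + 2 * (e x * d (x - \<tau>)) * \<psi> x"
      by (simp add: S'_def power2_eq_square algebra_simps)
    also have "\<dots> \<le> S x + 2 * c * S x + S x + S x * B + (S x + S x) * B"
      using 1 2 3 4 5 by linarith
    finally show ?thesis by (simp add: algebra_simps)
  qed
  also have "\<dots> < L * S x" using Sx \<open>\<epsilon> > 0\<close> by (simp add: L_def)
  finally have "S' x - L * (\<epsilon> * exp (L * (x - R))) < 0" using Sx by simp
  from DERIV_neg_dec_left[OF d_f this] obtain \<delta>
    where \<delta>: "\<delta> > 0" "\<And>h. 0 < h \<Longrightarrow> h < \<delta> \<Longrightarrow> f x < f (x - h)" by blast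
  define h where "h = min (\<delta> / 2) (x - R)"
  have "0 < h" "h < \<delta>" "R \<le> x - h" using \<delta> x by (auto simp: h_def)
  then show False using \<delta>(2)[of h] x(2) x(3)[of "x - h"] by simp
qed

section \<open>The weighted Wronskian\<close>

definition P where "P t = exp (- c * t) * (\<phi> t * \<psi> t)"
definition V where "V t = exp (- c * t) * (p t * \<psi> t - \<phi> t * r t)"
definition \<rho> where "\<rho> t = ln (\<phi> t) - ln (\<psi> t)"

lemma P_pos: "P t > 0" by (simp add: P_def W.pos X.pos)

lemma d_V: "(V has_real_derivative P t * (\<phi> (t - \<tau>) - \<psi> (t - \<tau>))) (at t)"
  unfolding V_def [abs_def] P_def
  by (rule derivative_eq_intros W.d_phi X.d_phi W.d_p X.d_p refl)+ (simp add: algebra_simps)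

lemma d_rho: "(\<rho> has_real_derivative V t / P t) (at t)"
proof -
  have "V t / P t = p t / \<phi> t - r t / \<psi> t"
    using W.pos[of t] X.pos[of t] by (simp add: V_def P_def field_simps)
  then show ?thesis unfolding \<rho>_def [abs_def] using W.pos[of t] X.pos[of t]
    by - ((rule derivative_eq_intros W.d_phi X.d_phi refl | assumption)+, simp)
qed

lemma rho_iff: "0 \<le> \<rho> t \<longleftrightarrow> \<psi> t \<le> \<phi> t" "\<rho> t = 0 \<longleftrightarrow> \<psi> t = \<phi> t"
  using W.pos[of t] X.pos[of t] by (auto simp: \<rho>_def)

text \<open>The pair \<open>(\<rho>, V)\<close> obeys a cooperative system, so the cone \<open>\<rho> \<ge> 0, V \<ge> 0\<close> is never left;
  inside it \<open>V\<close> cannot decay, although \<open>e\<^sup>c\<^sup>t V\<close> is bounded.\<close>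

lemma eq_of_V_nonneg:
  assumes lim: "(\<rho> \<longlongrightarrow> 0) at_bot" and V: "\<And>t. t \<le> T \<Longrightarrow> 0 \<le> V t" and "t \<le> T"
  shows "\<phi> t = \<psi> t"
proof -
  have rho0: "0 \<le> \<rho> x" if "\<And>s. s \<le> x \<Longrightarrow> 0 \<le> V s" for x
    by (rule deriv_le_at_bot[OF tendsto_const lim DERIV_const d_rho]) (use that P_pos in \<open>auto simp: less_imp_le\<close>)
  have V0: "V s = 0" if "s \<le> T" for s
  proof (rule ccontr)
    assume "V s \<noteq> 0"
    then have Vs: "V s > 0" using V[OF that] by simp
    \<comment> \<open>Halving leaves a strict gap at \<open>s\<close>. Up to a first crossing of
      \<open>V s / 2\<close>, \<open>V\<close> is nonnegative, hence so are \<open>\<rho>\<close>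
      and \<open>V'\<close>, and \<open>V\<close> cannot have dropped.\<close>
    have half: "V s / 2 < V b" if sb: "s \<le> b" for b
    proof (rule ccontr)
      assume n: "\<not> V s / 2 < V b"
      have cont: "isCont (\<lambda>x. V s / 2 - V x) x" for x
        using DERIV_isCont[OF d_V] by (intro continuous_intros)
      obtain x where x': "s < x" "V s / 2 - V x = 0" "\<And>y. s \<le> y \<Longrightarrow> y < x \<Longrightarrow> V s / 2 - V y < 0"
        by (rule first_zero[OF cont, of s b])
          (use Vs in linarith, use sb in linarith, use n in linarith, blast)
      then have x: "s < x" "V x = V s / 2" "\<And>y. s \<le> y \<Longrightarrow> y < x \<Longrightarrow> V s / 2 < V y"
        by (linarith | force)+
      have nn: "0 \<le> V y" if "y \<le> x" for y
        using V[of y] x(2) x(3)[of y] Vs that \<open>s \<le> T\<close> by (cases "y \<le> s"; cases "y = x") auto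
      have "V s \<le> V x"
      proof (rule deriv_nonneg_mono[OF _ d_V])
        fix y assume y: "s \<le> y" "y \<le> x"
        have "0 \<le> \<rho> (y - \<tau>)" by (rule rho0) (use nn W.tau y in auto)
        then show "0 \<le> P y * (\<phi> (y - \<tau>) - \<psi> (y - \<tau>))"
          using P_pos[of y] by (simp add: rho_iff)
      qed (use x in auto)
      then show False using x(2) Vs by simp
    qed
    \<comment> \<open>Bounds \<open>p \<psi> - \<phi> r\<close> from above by \<open>p_upper\<close>
      for \<open>p\<close> and \<open>p_lower\<close> for \<open>r\<close>.\<close>
    define K where "K = W.\<beta> * B * B + B * B\<^sup>2"
    have VK: "V b \<le> exp (- c * b) * K" for b
    proof -
      have "p b * \<psi> b \<le> W.\<beta> * B * \<psi> b" using W.p_upper[of b] X.pos[of b] by (intro mult_right_mono) auto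
      also have "\<dots> \<le> W.\<beta> * B * B" using X.bdd[of b] W.lam W.B_pos by (intro mult_left_mono) auto
      finally have 1: "p b * \<psi> b \<le> W.\<beta> * B * B" .
      have "\<phi> b * - r b \<le> \<phi> b * B\<^sup>2" using X.p_lower[of b] W.pos[of b] by (intro mult_left_mono) auto
      also have "\<dots> \<le> B * B\<^sup>2" using W.bdd[of b] by (intro mult_right_mono) auto
      finally show ?thesis unfolding V_def K_def using 1 by (intro mult_left_mono) auto
    qed
    have "((\<lambda>b. exp (- c * b) * K) \<longlongrightarrow> 0) at_top" using W.c2 by real_asymp
    from order_tendstoD(2)[OF this, of "V s / 2"] Vs obtain N
      where N: "\<And>b. b \<ge> N \<Longrightarrow> exp (- c * b) * K < V s / 2"
      by (auto simp: eventually_at_top_linorder)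
    show False using half[of "max s N"] VK[of "max s N"] N[of "max s N"] by simp
  qed
  have "\<rho> t \<le> 0"
    by (rule deriv_le_at_bot[OF lim tendsto_const d_rho DERIV_const]) (use V0 \<open>t \<le> T\<close> in auto)
  moreover have "0 \<le> \<rho> t" by (rule rho0) (use V \<open>t \<le> T\<close> in auto)
  ultimately show ?thesis using rho_iff(2)[of t] by simp
qed

text \<open>If \<open>V\<close> has zeros arbitrarily close to \<open>-\<infinity>\<close>, integrating \<open>V'\<close> from a zero and then \<open>\<rho>'\<close>
  from \<open>-\<infinity>\<close> is a contraction on \<open>\<rho>\<close>. The weight \<open>(A - t)\<^sup>2\<close> is needed for \<open>c = 2\<close>,
  where \<open>P\<close> grows like \<open>t\<^sup>2\<close>.\<close>

lemma eq_of_V_zeros: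
  assumes lim: "(\<rho> \<longlongrightarrow> 0) at_bot" and zeros: "\<And>T. \<exists>t\<le>T. V t = 0"
  shows "\<exists>T. \<forall>t\<le>T. \<phi> t = \<psi> t"
proof -
  obtain A1 T1 where A1: "T1 + 1 \<le> A1" "\<And>t. t \<le> T1 \<Longrightarrow> p t \<le> (c / 2 - 1 / (A1 - t)) * \<phi> t"
    using W.p_le_near by blast
  obtain A2 T2 where A2: "T2 + 1 \<le> A2" "\<And>t. t \<le> T2 \<Longrightarrow> r t \<le> (c / 2 - 1 / (A2 - t)) * \<psi> t"
    using X.p_le_near by blast
  define A where "A = max A1 A2"
  obtain C k T3 where C: "C > 0" "k > 0"
    "\<And>t. t \<le> T3 \<Longrightarrow> A - t \<ge> 1 \<and> (A - t)\<^sup>2 * \<psi> (t - \<tau>) \<le> C * exp (k * t)"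
    using X.decay_sq by metis
  have "\<forall>\<^sub>F t in at_bot. \<bar>\<rho> t\<bar> < 1"
    using order_tendstoD[OF lim, of 1] order_tendstoD[OF lim, of "-1"]
    by (auto elim: eventually_elim2)
  then obtain T4 where T4: "\<And>t. t \<le> T4 \<Longrightarrow> \<bar>\<rho> t\<bar> < 1" by (auto simp: eventually_at_bot_linorder)
  \<comment> \<open>\<open>C / k exp (k t)\<close> is the integral of \<open>C exp (k s)\<close>
    over \<open>s \<le> t\<close>, and the 2 comes from \<open>abs_exp_minus_one_le\<close>; keeping
    the product below \<open>1 / 2\<close> gives the contraction factor.\<close>
  have "((\<lambda>t. 2 * (C / k * exp (k * t))) \<longlongrightarrow> 0) at_bot" using C(2) by real_asymp
  from order_tendstoD(2)[OF this, of "1/2"] obtain T5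
    where T5: "\<And>t. t \<le> T5 \<Longrightarrow> 2 * (C / k * exp (k * t)) < 1 / 2" by (auto simp: eventually_at_bot_linorder)
  obtain T where T: "T \<le> min T1 (min T2 (min T3 (min T4 T5)))" "V T = 0" using zeros by blast
  have l1: "A - t \<ge> 1" if "t \<le> T" for t using C(3)[of t] that T by auto
  have P_anti: "P s / (A - s)\<^sup>2 \<le> P t / (A - t)\<^sup>2" if "t \<le> s" "s \<le> T" for s t
  proof (rule deriv_nonpos_antimono[OF \<open>t \<le> s\<close>])
    fix x assume x: "t \<le> x" "x \<le> s"
    have lx: "A - x \<ge> 1" using x that l1 by simp
    have dP: "(P has_real_derivative exp (- c * x) * (p x * \<psi> x + \<phi> x * r x - c * (\<phi> x * \<psi> x))) (at x)"
      unfolding P_def [abs_def]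
      by (rule derivative_eq_intros W.d_phi X.d_phi refl)+ (simp add: algebra_simps)
    show "((\<lambda>x. P x / (A - x)\<^sup>2) has_real_derivative
        (exp (- c * x) * (p x * \<psi> x + \<phi> x * r x - c * (\<phi> x * \<psi> x)) + 2 * P x / (A - x)) / (A - x)\<^sup>2) (at x)"
    proof -
      have eq: "(D * l\<^sup>2 - Q * - (2 * l)) / (l\<^sup>2 * l\<^sup>2) = (D + 2 * Q / l) / l\<^sup>2" if "l \<noteq> 0" for D Q l :: real
        using that by (simp add: field_simps power2_eq_square)
      have "((\<lambda>x. (A - x)\<^sup>2) has_real_derivative - (2 * (A - x))) (at x)"
        by (auto intro!: derivative_eq_intros)
      from DERIV_divide[OF dP this] show ?thesis using lx by (subst eq[symmetric]) auto
    qed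
    have "p x \<le> (c / 2 - 1 / (A1 - x)) * \<phi> x" "r x \<le> (c / 2 - 1 / (A2 - x)) * \<psi> x"
      using A1(2)[of x] A2(2)[of x] x that T by auto
    moreover have "(c / 2 - 1 / (A1 - x)) * \<phi> x \<le> (c / 2 - 1 / (A - x)) * \<phi> x"
      using W.pos[of x] A1(1) x that T by (intro mult_right_mono) (auto simp: A_def intro!: divide_left_mono)
    moreover have "(c / 2 - 1 / (A2 - x)) * \<psi> x \<le> (c / 2 - 1 / (A - x)) * \<psi> x"
      using X.pos[of x] A2(1) x that T by (intro mult_right_mono) (auto simp: A_def intro!: divide_left_mono)
    ultimately have px: "p x \<le> (c / 2 - 1 / (A - x)) * \<phi> x" and rx: "r x \<le> (c / 2 - 1 / (A - x)) * \<psi> x"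
      by linarith+
    have "p x * \<psi> x + \<phi> x * r x \<le> (c / 2 - 1 / (A - x)) * \<phi> x * \<psi> x + \<phi> x * ((c / 2 - 1 / (A - x)) * \<psi> x)"
      using px rx W.pos[of x] X.pos[of x] by (intro add_mono mult_right_mono mult_left_mono) auto
    then have "p x * \<psi> x + \<phi> x * r x - c * (\<phi> x * \<psi> x) \<le> - 2 * (\<phi> x * \<psi> x) / (A - x)"
      by (simp add: algebra_simps)
    then have "exp (- c * x) * (p x * \<psi> x + \<phi> x * r x - c * (\<phi> x * \<psi> x))
        \<le> exp (- c * x) * (- 2 * (\<phi> x * \<psi> x) / (A - x))" by (intro mult_left_mono) auto
    then have "exp (- c * x) * (p x * \<psi> x + \<phi> x * r x - c * (\<phi> x * \<psi> x)) + 2 * P x / (A - x) \<le> 0"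
      by (simp add: P_def algebra_simps)
    then show "(exp (- c * x) * (p x * \<psi> x + \<phi> x * r x - c * (\<phi> x * \<psi> x)) + 2 * P x / (A - x)) / (A - x)\<^sup>2 \<le> 0"
      by (simp add: divide_le_0_iff)
  qed
  have step: "\<bar>\<rho> t\<bar> \<le> M / 2" if M: "0 \<le> M" "M \<le> 1" "\<And>s. s \<le> T \<Longrightarrow> \<bar>\<rho> s\<bar> \<le> M" and t: "t \<le> T" for M t
  proof -
    \<comment> \<open>Integrate \<open>V'\<close> from \<open>x\<close> to the zero
      \<open>T\<close>. By \<open>P_anti\<close>, \<open>P s\<close> is at most
      \<open>(A - s)\<^sup>2\<close> times the constant \<open>D\<close>, and the decay of
      \<open>\<psi>\<close> absorbs that weight.\<close>
    have Vb: "\<bar>V x / P x\<bar> \<le> M / 2 / (A - x)\<^sup>2" if x: "x \<le> T" for x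
    proof -
      define D where "D = P x / (A - x)\<^sup>2"
      have "D \<ge> 0" using P_pos[of x] by (simp add: D_def)
      have "\<bar>V T - V x\<bar> \<le> 2 * M * D * (C / k * exp (k * T)) - 2 * M * D * (C / k * exp (k * x))"
      proof (rule abs_deriv_le_diff[OF x d_V])
        fix s assume s: "x \<le> s" "s \<le> T"
        show "((\<lambda>s. 2 * M * D * (C / k * exp (k * s))) has_real_derivative 2 * M * D * (C * exp (k * s))) (at s)"
          using C(2) by - ((rule derivative_eq_intros refl)+, simp)
        have "\<bar>\<rho> (s - \<tau>)\<bar> \<le> M" using M(3) W.tau s by simp
        moreover have "\<phi> (s - \<tau>) = \<psi> (s - \<tau>) * exp (\<rho> (s - \<tau>))"
          using W.pos[of "s - \<tau>"] X.pos[of "s - \<tau>"] by (simp add: \<rho>_def exp_diff)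
        moreover have "\<bar>exp (\<rho> (s - \<tau>)) - 1\<bar> \<le> 2 * \<bar>\<rho> (s - \<tau>)\<bar>"
          using M calculation(1) by (intro abs_exp_minus_one_le) auto
        ultimately have "\<phi> (s - \<tau>) - \<psi> (s - \<tau>) = \<psi> (s - \<tau>) * (exp (\<rho> (s - \<tau>)) - 1)"
            "\<bar>exp (\<rho> (s - \<tau>)) - 1\<bar> \<le> 2 * M"
          by (simp add: right_diff_distrib, linarith)
        then have "\<bar>\<phi> (s - \<tau>) - \<psi> (s - \<tau>)\<bar> \<le> \<psi> (s - \<tau>) * (2 * M)"
          using X.pos[of "s - \<tau>"] by (simp only: abs_mult) simp
        then have "\<bar>P s * (\<phi> (s - \<tau>) - \<psi> (s - \<tau>))\<bar> \<le> P s * (\<psi> (s - \<tau>) * (2 * M))"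
          using P_pos[of s] by (simp add: abs_mult)
        also have "\<dots> = 2 * M * (P s / (A - s)\<^sup>2) * ((A - s)\<^sup>2 * \<psi> (s - \<tau>))"
          using l1[OF s(2)] by simp
        also have "\<dots> \<le> 2 * M * D * (C * exp (k * s))"
        proof (rule mult_mono)
          show "2 * M * (P s / (A - s)\<^sup>2) \<le> 2 * M * D"
            unfolding D_def by (rule mult_left_mono[OF P_anti[OF s]]) (use M in simp)
          show "(A - s)\<^sup>2 * \<psi> (s - \<tau>) \<le> C * exp (k * s)" using C(3)[of s] s T by simp
        qed (use M(1) \<open>D \<ge> 0\<close> X.pos[of "s - \<tau>"] in auto)
        finally show "\<bar>P s * (\<phi> (s - \<tau>) - \<psi> (s - \<tau>))\<bar> \<le> 2 * M * D * (C * exp (k * s))" .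
      qed
      also have "\<dots> \<le> 2 * M * D * (C / k * exp (k * T))" using M(1) \<open>D \<ge> 0\<close> C by simp
      also have "\<dots> = M * D * (2 * (C / k * exp (k * T)))" by simp
      also have "\<dots> \<le> M * D * (1 / 2)"
        using T5[of T] T M(1) \<open>D \<ge> 0\<close> by (intro mult_left_mono) auto
      finally have "\<bar>V x\<bar> \<le> M / 2 * D" using T(2) by simp
      then show ?thesis using P_pos[of x] by (simp add: D_def abs_divide pos_divide_le_eq)
    qed
    \<comment> \<open>\<open>1 / (A - x)\<^sup>2\<close> is integrable at -\<infinity>, with
      integral \<open>1 / (A - t) \<le> 1\<close>.\<close>
    have "\<bar>\<rho> t\<bar> \<le> M / 2 / (A - t)"
    proof (rule abs_deriv_le_at_bot[OF lim _ d_rho])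
      show "((\<lambda>t. M / 2 / (A - t)) \<longlongrightarrow> 0) at_bot" by real_asymp
      fix x assume x: "x \<le> t"
      have "A - x \<ge> 1" using l1 x t by simp
      then show "((\<lambda>t. M / 2 / (A - t)) has_real_derivative M / 2 / (A - x)\<^sup>2) (at x)"
        by - ((rule derivative_eq_intros refl | simp)+, simp add: power2_eq_square)
      show "\<bar>V x / P x\<bar> \<le> M / 2 / (A - x)\<^sup>2" using Vb x t by simp
    qed
    also have "\<dots> \<le> M / 2 / 1" using l1[OF t] M(1) by (intro divide_left_mono) auto
    finally show ?thesis by simp
  qed
  have pow: "\<bar>\<rho> t\<bar> \<le> (1 / 2) ^ n" if "t \<le> T" for n t
    using that
  proof (induction n arbitrary: t)
    case 0
    then show ?case using T4[of t] T by simp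
  next
    case (Suc n)
    have "\<bar>\<rho> t\<bar> \<le> (1 / 2) ^ n / 2" by (rule step) (use Suc in \<open>auto simp: power_le_one\<close>)
    then show ?case by simp
  qed
  have "\<phi> t = \<psi> t" if "t \<le> T" for t
  proof -
    have "\<bar>\<rho> t\<bar> \<le> 0"
      by (rule tendsto_lowerbound[of "\<lambda>n. (1 / 2 :: real) ^ n" _ sequentially])
        (use pow[OF that] in \<open>auto intro!: LIMSEQ_power_zero always_eventually\<close>)
    then show ?thesis using rho_iff(2)[of t] by simp
  qed
  then show ?thesis by blast
qed

end

text \<open>Either \<open>V\<close> vanishes arbitrarily far to the left, or by continuity it has
  one sign there; exchanging the two profiles changes that sign, so both signs reduce to
  \<open>eq_of_V_nonneg\<close>. \<open>eq_forward\<close> extends the equality to all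
  times.\<close>

lemma wave_eq_of_ratio:
  assumes "wave c \<tau> B \<phi> p" "wave c \<tau> B \<psi> r" and lim: "((\<lambda>t. \<phi> t / \<psi> t) \<longlongrightarrow> 1) at_bot"
  shows "\<phi> t = \<psi> t"
proof -
  interpret two_waves c \<tau> B \<phi> p \<psi> r using assms(1,2) by (simp add: two_waves_def)
  interpret Y: two_waves c \<tau> B \<psi> r \<phi> p using assms(1,2) by (simp add: two_waves_def)
  have "((\<lambda>t. ln (\<phi> t / \<psi> t)) \<longlongrightarrow> ln 1) at_bot" by (intro tendsto_ln lim) simp
  then have l: "(\<rho> \<longlongrightarrow> 0) at_bot"
  proof -
    have "ln (\<phi> t / \<psi> t) = \<rho> t" for t using W.pos[of t] X.pos[of t] by (simp add: \<rho>_def ln_div)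
    with \<open>((\<lambda>t. ln (\<phi> t / \<psi> t)) \<longlongrightarrow> ln 1) at_bot\<close> show ?thesis by simp
  qed
  have "Y.\<rho> = (\<lambda>t. - \<rho> t)" by (simp add: \<rho>_def Y.\<rho>_def fun_eq_iff)
  then have l': "(Y.\<rho> \<longlongrightarrow> 0) at_bot" using tendsto_minus[OF l] by simp
  have Y: "Y.V t = - V t" for t by (simp add: V_def Y.V_def algebra_simps)
  have cont: "isCont V x" for x using DERIV_isCont[OF d_V] .
  have "\<exists>T. \<forall>t\<le>T. \<phi> t = \<psi> t"
  proof (cases "\<forall>T. \<exists>t\<le>T. V t = 0")
    case True
    then show ?thesis using eq_of_V_zeros[OF l] by blast
  next
    case False
    then obtain T where T: "\<And>t. t \<le> T \<Longrightarrow> V t \<noteq> 0" by blast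
    have sgn: "0 < V t \<longleftrightarrow> 0 < V T" if "t \<le> T" for t
    proof (rule ccontr)
      assume "\<not> (0 < V t \<longleftrightarrow> 0 < V T)"
      then have "(V t \<le> 0 \<and> 0 \<le> V T) \<or> (V T \<le> 0 \<and> 0 \<le> V t)" by linarith
      then have "\<exists>x\<ge>t. x \<le> T \<and> V x = 0"
        by (elim disjE) (use IVT[of V t 0 T] IVT2[of V T 0 t] cont that in auto)
      then show False using T by blast
    qed
    show ?thesis
    proof (cases "0 < V T")
      case True
      then have nn: "0 \<le> V t" if "t \<le> T" for t using sgn[OF that] by simp
      show ?thesis by (intro exI[of _ T] allI impI eq_of_V_nonneg[OF l nn])
    next
      case False
      then have nn: "0 \<le> Y.V t" if "t \<le> T" for t using sgn[OF that] by (simp add: Y)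
      show ?thesis by (intro exI[of _ T] allI impI Y.eq_of_V_nonneg[OF l' nn, symmetric])
    qed
  qed
  then show ?thesis using eq_forward by blast
qed

theorem wave_unique:
  assumes "wave c \<tau> B \<phi> p" "wave c \<tau> B \<psi> r"
  shows "\<exists>s. \<forall>t. \<phi> (t + s) = \<psi> t"
proof -
  interpret W: wave c \<tau> B \<phi> p by fact
  interpret X: wave c \<tau> B \<psi> r by fact
  obtain a where a: "a > 0" "(W.H \<longlongrightarrow> a) at_bot" using W.H_lim by blast
  obtain b where b: "b > 0" "(X.H \<longlongrightarrow> b) at_bot" using X.H_lim by blast
  \<comment> \<open>Translation by \<open>s\<close> multiplies the limit of \<open>H\<close> by
    \<open>exp (\<alpha> s)\<close>.\<close>
  define s where "s = ln (b / a) / lam1 c"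
  interpret Y: wave c \<tau> B "\<lambda>t. \<phi> (t + s)" "\<lambda>t. p (t + s)" by (rule W.shift)
  have "filterlim (\<lambda>t. t + s) at_bot at_bot" by real_asymp
  then have "((\<lambda>t. exp (lam1 c * s) * W.H (t + s)) \<longlongrightarrow> exp (lam1 c * s) * a) at_bot"
    by (intro tendsto_mult tendsto_const filterlim_compose[OF a(2)])
  moreover have "exp (lam1 c * s) * W.H (t + s) = Y.H t" for t
    by (simp add: W.H_def Y.H_def algebra_simps flip: exp_add)
  moreover have "exp (lam1 c * s) * a = b" using W.lam a b by (simp add: s_def)
  ultimately have Yb: "(Y.H \<longlongrightarrow> b) at_bot" by simp
  \<comment> \<open>The weights \<open>exp (- \<mu> t)\<close> cancel in the quotient of
    derivatives, leaving the quotient of the two \<open>H\<close>.\<close>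
  have "((\<lambda>t. Y.v t / X.v t) \<longlongrightarrow> b / b) at_bot"
  proof (rule lhopital_at_bot[OF X.v_at_top Y.d_v X.d_v])
    show "- (exp (- X.\<mu> * t) * X.H t) \<noteq> 0" for t using X.H_pos[of t] by simp
    show "((\<lambda>t. - (exp (- Y.\<mu> * t) * Y.H t) / - (exp (- X.\<mu> * t) * X.H t)) \<longlongrightarrow> b / b) at_bot"
      using tendsto_divide[OF Yb b(2)] b(1) by simp
  qed
  moreover have "Y.v t / X.v t = \<phi> (t + s) / \<psi> t" for t by (simp add: X.v_def Y.v_def)
  ultimately have "((\<lambda>t. \<phi> (t + s) / \<psi> t) \<longlongrightarrow> 1) at_bot" using b(1) by simp
  then show ?thesis using wave_eq_of_ratio[OF Y.wave_axioms X.wave_axioms] by blast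
qed

section \<open>The discretised equation\<close>

text \<open>An Euler scheme whose linear part has the real characteristic roots \<open>1 + lam1 c * \<delta>\<close> and
  \<open>1 + lam2 c * \<delta>\<close>, even for \<open>c = 2\<close>. Truncated subtraction in \<open>k - m\<close> makes the initial
  history constant.\<close>

fun scheme :: "real \<Rightarrow> real \<Rightarrow> nat \<Rightarrow> real \<Rightarrow> real \<Rightarrow> nat \<Rightarrow> real" where
  "scheme c \<delta> m \<epsilon> q 0 = \<epsilon>"
| "scheme c \<delta> m \<epsilon> q (Suc 0) = q * \<epsilon>"
| "scheme c \<delta> m \<epsilon> q (Suc (Suc k)) =
    (2 + c * \<delta> + \<delta>\<^sup>2 * scheme c \<delta> m \<epsilon> q (k - m)) * scheme c \<delta> m \<epsilon> q (Suc k)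
    - (1 + c * \<delta> + \<delta>\<^sup>2) * scheme c \<delta> m \<epsilon> q k"

lemma continuous_scheme: "continuous_on UNIV (\<lambda>q. scheme c \<delta> m \<epsilon> q k)"
  by (induction c \<delta> m \<epsilon> "0::real" k rule: scheme.induct) (auto intro!: continuous_intros)

text \<open>The initial ratios \<open>q\<close> for which \<open>x\<close> becomes negative and those for which \<open>x (k + 1) / x k\<close>
  exceeds \<open>1 + lam2 c * \<delta>\<close> while \<open>x > 0\<close> form two disjoint nonempty open sets; any other \<open>q\<close> will do.\<close>

lemma shooting:
  fixes c \<delta> \<epsilon> :: real and m :: nat
  assumes "c \<ge> 2" and "\<delta> > 0" and "\<epsilon> > 0"
  obtains x where "x 0 = \<epsilon>" "\<And>k. 0 < x k" "\<And>k. x (Suc k) \<le> (1 + lam2 c * \<delta>) * x k"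
    "\<And>k. x (Suc (Suc k)) = (2 + c * \<delta> + \<delta>\<^sup>2 * x (k - m)) * x (Suc k) - (1 + c * \<delta> + \<delta>\<^sup>2) * x k"
proof -
  note lam = lam_props[OF assms(1)]
  define a1 where "a1 = 1 + lam1 c * \<delta>"
  define a2 where "a2 = 1 + lam2 c * \<delta>"
  have a: "a1 > 1" "a2 > 1" using lam assms by (auto simp: a1_def a2_def)
  have "a1 * a2 = 1 + (lam1 c + lam2 c) * \<delta> + (lam1 c * lam2 c) * \<delta>\<^sup>2"
    by (simp add: a1_def a2_def algebra_simps power2_eq_square)
  then have a12: "1 + c * \<delta> + \<delta>\<^sup>2 = a1 * a2" using lam by simp
  have "a1 + a2 = 2 + (lam1 c + lam2 c) * \<delta>" by (simp add: a1_def a2_def algebra_simps)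
  then have apl: "2 + c * \<delta> = a1 + a2" using lam by simp
  define X where "X q = scheme c \<delta> m \<epsilon> q" for q
  have X0: "X q 0 = \<epsilon>" "X q (Suc 0) = q * \<epsilon>" for q by (auto simp: X_def)
  have X_rec: "X q (Suc (Suc k)) = (a1 + a2 + \<delta>\<^sup>2 * X q (k - m)) * X q (Suc k) - a1 * a2 * X q k" for q k
    by (simp only: X_def scheme.simps a12 apl)
  have cont: "continuous_on UNIV (\<lambda>q. X q k)" for k unfolding X_def by (rule continuous_scheme)
  \<comment> \<open>The discrete counterpart of \<open>p - \<beta> \<phi>\<close>. By
    \<open>g_rec\<close>, once positive while \<open>x\<close> has been positive it stays positive,
    and so does \<open>x\<close>; hence \<open>A\<close> and \<open>U\<close> are disjoint.\<close>
  define g where "g q k = X q (Suc k) - a2 * X q k" for q k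
  have g_rec: "g q (Suc k) = a1 * g q k + \<delta>\<^sup>2 * X q (k - m) * X q (Suc k)" for q k
    unfolding g_def X_rec by (simp add: algebra_simps)
  have contg: "continuous_on UNIV (\<lambda>q. g q k)" for k
    unfolding g_def by (intro continuous_intros cont)
  define A where "A = (\<Union>k. {q. X q k < 0})"
  define U where "U = (\<Union>k. {q. 0 < g q k} \<inter> (\<Inter>j\<in>{..k}. {q. 0 < X q j}))"
  have "open A" unfolding A_def by (intro open_UN ballI open_Collect_less cont continuous_on_const)
  moreover have "open U" unfolding U_def
    by (intro open_UN ballI open_Int open_INT finite_atMost open_Collect_less cont contg continuous_on_const)
  moreover have "A \<inter> U = {}"
  proof (rule ccontr)
    assume "A \<inter> U \<noteq> {}"
    then obtain q k k' where k: "X q k' < 0" "0 < g q k" "\<And>j. j \<le> k \<Longrightarrow> 0 < X q j"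
      unfolding A_def U_def by auto
    have "0 < g q (k + i) \<and> (\<forall>j\<le>k + i. 0 < X q j)" for i
    proof (induction i)
      case (Suc i)
      have "X q (Suc (k + i)) = g q (k + i) + a2 * X q (k + i)" by (simp add: g_def)
      also have "\<dots> > 0" using Suc a by (intro add_pos_pos mult_pos_pos) auto
      finally have 1: "0 < X q (Suc (k + i))" .
      have "0 < a1 * g q (k + i)" using Suc a by simp
      moreover have "0 < \<delta>\<^sup>2 * X q (k + i - m) * X q (Suc (k + i))"
        using Suc 1 assms by (intro mult_pos_pos) auto
      ultimately have "0 < g q (Suc (k + i))" unfolding g_rec by linarith
      then show ?case using 1 Suc by (auto simp: le_Suc_eq)
    qed (use k in auto)
    from this[of k'] have "0 < X q k'" by simp
    then show False using k(1) by simp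
  qed
  \<comment> \<open>The ratio -1 makes the second value negative; the ratio \<open>a2 + 1\<close>
    gives \<open>g = \<epsilon> > 0\<close> at once.\<close>
  moreover have "- 1 \<in> A" using assms X0[of "- 1"] unfolding A_def by (auto intro!: exI[of _ "Suc 0"])
  moreover have "a2 + 1 \<in> U" using assms X0[of "a2 + 1"]
    unfolding U_def by (auto intro!: exI[of _ 0] simp: g_def algebra_simps)
  ultimately have "\<exists>q. q \<notin> A \<and> q \<notin> U"
    using connectedD[OF connected_UNIV, of A U] by blast
  then obtain q where q: "q \<notin> A" "q \<notin> U" by blast
  have nonneg: "0 \<le> X q k" for k using q(1) by (auto simp: A_def not_less)
  have pos: "0 < X q k" for k
  proof (induction k rule: less_induct)
    case (less k)
    show ?case
    proof (cases k)
      case (Suc l)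
      show ?thesis
      proof (rule ccontr)
        assume "\<not> ?thesis"
        \<comment> \<open>A zero after a positive value would make the next value negative, so
          nonnegativity is already strict.\<close>
        then have "X q (Suc l) = 0" using nonneg[of k] Suc by simp
        then have "X q (Suc (Suc l)) = - (a1 * a2 * X q l)" by (simp add: X_rec)
        moreover have "0 < a1 * a2 * X q l" using less[of l] Suc a by (intro mult_pos_pos) auto
        ultimately show False using nonneg[of "Suc (Suc l)"] by linarith
      qed
    qed (use assms X0 in simp)
  qed
  then have "g q k \<le> 0" for k using q(2) by (force simp: U_def not_less)
  then show thesis using X0[of q] pos X_rec[of q]
    by (intro that[of "X q"]) (auto simp: g_def a2_def[symmetric] a12 apl)
qed

section \<open>Discrete Lipschitz, Taylor and descent estimates\<close>

lemma lipschitz_of_steps: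
  fixes y :: "nat \<Rightarrow> real"
  assumes "\<And>k. min i j \<le> k \<Longrightarrow> k < max i j \<Longrightarrow> \<bar>y (Suc k) - y k\<bar> \<le> \<kappa>"
  shows "\<bar>y i - y j\<bar> \<le> \<kappa> * \<bar>real i - real j\<bar>"
proof -
  have *: "\<bar>y b - y a\<bar> \<le> \<kappa> * (real b - real a)"
    if "a \<le> b" "\<And>k. a \<le> k \<Longrightarrow> k < b \<Longrightarrow> \<bar>y (Suc k) - y k\<bar> \<le> \<kappa>" for a b
    using that
  proof (induction b rule: dec_induct)
    case (step b)
    then have "\<bar>y b - y a\<bar> \<le> \<kappa> * (real b - real a)" "\<bar>y (Suc b) - y b\<bar> \<le> \<kappa>" by auto
    moreover have "\<kappa> * (real (Suc b) - real a) = \<kappa> * (real b - real a) + \<kappa>" by (simp add: algebra_simps)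
    ultimately show ?case by linarith
  qed simp
  show ?thesis using *[of i j] *[of j i] assms by (cases "i \<le> j") (auto simp: abs_minus_commute)
qed

text \<open>After subtracting the line of slope \<open>G j\<close>, each step is at most
  \<open>\<delta> (\<eta> + \<Lambda> N)\<close>, because \<open>G\<close> moves by at most
  \<open>\<Lambda> N\<close> between the two indices.\<close>

lemma taylor_of_steps:
  fixes y G :: "nat \<Rightarrow> real" and i j :: nat
  assumes "\<delta> \<ge> 0" "\<Lambda> \<ge> 0" and y: "\<And>k. \<bar>y (Suc k) - y k - \<delta> * G k\<bar> \<le> \<delta> * \<eta>"
    and G: "\<And>k. \<bar>G (Suc k) - G k\<bar> \<le> \<delta> * \<Lambda>"
  defines "N \<equiv> \<delta> * \<bar>real i - real j\<bar>"
  shows "\<bar>y i - y j - \<delta> * (real i - real j) * G j\<bar> \<le> N * (\<eta> + \<Lambda> * N)"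
proof -
  have "\<bar>(y i - \<delta> * real i * G j) - (y j - \<delta> * real j * G j)\<bar> \<le> (\<delta> * (\<eta> + \<Lambda> * N)) * \<bar>real i - real j\<bar>"
  proof (rule lipschitz_of_steps)
    fix k assume k: "min i j \<le> k" "k < max i j"
    have "\<bar>G k - G j\<bar> \<le> \<delta> * \<Lambda> * \<bar>real k - real j\<bar>" using lipschitz_of_steps[of k j G "\<delta> * \<Lambda>"] G by blast
    also have "\<dots> \<le> \<delta> * \<Lambda> * \<bar>real i - real j\<bar>"
      using assms(1,2) k by (intro mult_left_mono) auto
    finally have "\<delta> * \<bar>G k - G j\<bar> \<le> \<delta> * (\<Lambda> * N)"
      using assms(1) by (intro mult_left_mono) (auto simp: N_def mult_ac)
    then have "\<bar>\<delta> * (G k - G j)\<bar> \<le> \<delta> * (\<Lambda> * N)" using assms(1) by (simp add: abs_mult)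
    moreover have "(y (Suc k) - \<delta> * real (Suc k) * G j) - (y k - \<delta> * real k * G j)
        = (y (Suc k) - y k - \<delta> * G k) + \<delta> * (G k - G j)" by (simp add: algebra_simps)
    ultimately show "\<bar>(y (Suc k) - \<delta> * real (Suc k) * G j) - (y k - \<delta> * real k * G j)\<bar> \<le> \<delta> * (\<eta> + \<Lambda> * N)"
      using y[of k] by (simp only: distrib_left)
  qed
  then show ?thesis by (simp add: N_def algebra_simps)
qed

lemma no_linear_descent:
  fixes y :: "nat \<Rightarrow> real"
  assumes "\<kappa> > 0" "\<And>k. k0 \<le> k \<Longrightarrow> y (Suc k) \<le> y k - \<kappa>" "\<And>k. y k \<ge> b"
  shows False
proof -
  have *: "y (k0 + i) \<le> y k0 - real i * \<kappa>" for i
  proof (induction i)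
    case (Suc i)
    then show ?case using assms(2)[of "k0 + i"] by (simp add: algebra_simps)
  qed simp
  obtain i :: nat where "y k0 - b < real i * \<kappa>" using ex_less_of_nat_mult[OF assms(1)] by blast
  then show False using *[of i] assms(3)[of "k0 + i"] by linarith
qed

section \<open>Bounds for the scheme, uniform in the step size\<close>

locale discrete_wave =
  fixes c \<tau> \<delta> \<epsilon> :: real and m :: nat and x :: "nat \<Rightarrow> real"
  assumes c2: "c \<ge> 2" and tau: "\<tau> \<ge> 0" and delta: "\<delta> > 0" "\<delta> \<le> 1" "lam2 c * \<delta> \<le> 1 / 2"
    and m: "real m * \<delta> \<le> \<tau>" "\<tau> \<le> real m * \<delta> + \<delta>" and eps: "0 < \<epsilon>" "\<epsilon> < 1 / 2"
    and x0: "x 0 = \<epsilon>" and pos: "\<And>k. 0 < x k"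
    and growth: "\<And>k. x (Suc k) \<le> (1 + lam2 c * \<delta>) * x k"
    and rec: "\<And>k. x (Suc (Suc k)) =
      (2 + c * \<delta> + \<delta>\<^sup>2 * x (k - m)) * x (Suc k) - (1 + c * \<delta> + \<delta>\<^sup>2) * x k"
begin

abbreviation "\<beta> \<equiv> lam2 c"

lemmas lam = lam_props[OF c2]

lemma growth_exp: "x (k + i) \<le> exp (\<beta> * \<delta> * real i) * x k"
proof (induction i)
  case (Suc i)
  have "x (k + Suc i) \<le> (1 + \<beta> * \<delta>) * x (k + i)" using growth[of "k + i"] by simp
  also have "\<dots> \<le> exp (\<beta> * \<delta>) * (exp (\<beta> * \<delta> * real i) * x k)"
    using Suc pos exp_ge_add_one_self[of "\<beta> * \<delta>"] by (intro mult_mono) (auto simp: less_imp_le)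
  also have "\<dots> = exp (\<beta> * \<delta> * real (Suc i)) * x k"
    by (simp add: algebra_simps flip: exp_add)
  finally show ?case .
qed simp

text \<open>Over a time of at most \<open>\<tau> + 1\<close>, the delay and one more step,
  \<open>x\<close> grows at most by the factor \<open>exp (\<beta> (\<tau> + 1))\<close>; a value of
  \<open>M\<close> therefore forces a delayed value of at least 2.\<close>

definition M where "M = 2 * exp (\<beta> * (\<tau> + 1))"

lemma M2: "M \<ge> 2" using lam tau by (simp add: M_def)

text \<open>Once \<open>x\<close> reaches \<open>M\<close>, the delayed value stays above \<open>2\<close> and the ratio
  \<open>x (k + 1) / x k\<close> increases by \<open>\<delta>\<^sup>2\<close> in each step, beyond the bound \<open>1 + \<beta> \<delta>\<close>.\<close>

lemma x_less_M: "x k < M"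
proof (rule ccontr)
  assume "\<not> x k < M"
  then have ex: "\<exists>k. M \<le> x k" by (auto simp: not_less)
  define K where "K = (LEAST k. M \<le> x k)"
  have K: "M \<le> x K" "\<And>j. j < K \<Longrightarrow> x j < M"
    unfolding K_def using LeastI_ex[OF ex] not_less_Least by (auto simp: not_le[symmetric])
  have "K \<noteq> 0" using K(1) x0 eps M2 by (cases K) auto
  then obtain l where l: "K = Suc l" by (cases K) auto
  have *: "(1 + real i * \<delta>\<^sup>2) * x (l + i) \<le> x (Suc (l + i)) \<and> (\<forall>n. K \<le> n \<and> n \<le> Suc (l + i) \<longrightarrow> M \<le> x n)" for i
  proof (induction i)
    case 0
    show ?case using K l by (auto simp: less_imp_le le_antisym dest: K(2)) (metis K less_imp_le lessI order.trans)
  next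
    case (Suc i)
    define j where "j = l + i"
    have IH1: "(1 + real i * \<delta>\<^sup>2) * x j \<le> x (Suc j)" using Suc by (simp add: j_def)
    have IH2: "M \<le> x n" if "K \<le> n" "n \<le> Suc j" for n using Suc that by (auto simp: j_def)
    have two: "2 \<le> x (j - m)"
    proof (cases "K \<le> j - m")
      case True
      have "M \<le> x (j - m)" by (rule IH2[OF True]) simp
      then show ?thesis using M2 by simp
    next
      case False
      define n where "n = j - m"
      \<comment> \<open>Even if \<open>n\<close> is truncated to 0, at most \<open>m + 1\<close>
        steps lead from \<open>n\<close> to \<open>K\<close>, because
        \<open>K \<le> j + 1\<close>.\<close>
      have n: "n + (K - n) = K" "K - n \<le> m + 1" using False l by (auto simp: n_def j_def)
      have "M \<le> x (n + (K - n))" using K n by simp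
      also have "\<dots> \<le> exp (\<beta> * \<delta> * real (K - n)) * x n" by (rule growth_exp)
      also have "\<dots> \<le> exp (\<beta> * (\<tau> + 1)) * x n"
      proof -
        have "\<delta> * real (K - n) \<le> \<delta> * real (m + 1)" using n(2) delta by (intro mult_left_mono) auto
        also have "\<dots> \<le> \<tau> + 1" using m(1) delta by (simp add: algebra_simps)
        finally have "\<beta> * (\<delta> * real (K - n)) \<le> \<beta> * (\<tau> + 1)" using lam by (intro mult_left_mono) auto
        then show ?thesis using pos[of n] by (simp add: mult.assoc)
      qed
      finally show ?thesis by (simp add: M_def n_def mult.commute)
    qed
    have XY: "x j \<le> x (Suc j)"
    proof -
      have "1 * x j \<le> (1 + real i * \<delta>\<^sup>2) * x j" using pos[of j] by (intro mult_right_mono) auto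
      then show ?thesis using IH1 by simp
    qed
    \<comment> \<open>Let \<open>r\<close> be the ratio \<open>x (Suc j) / x j\<close> and
      \<open>b\<close> stand for \<open>?b\<close>. As \<open>1 \<le> r \<le> b\<close>, one has
      \<open>r + b / r \<le> 1 + b\<close>; with a delayed value of at least 2, the next ratio is at
      least \<open>1 + b + \<delta>\<^sup>2 - b / r \<ge> r + \<delta>\<^sup>2\<close>.\<close>
    let ?b = "1 + c * \<delta> + \<delta>\<^sup>2"
    have "x (Suc j) \<le> ?b * x j"
    proof -
      have "\<beta> \<le> c" using lam by linarith
      then have "\<beta> * \<delta> \<le> c * \<delta>" using delta by simp
      then have "(1 + \<beta> * \<delta>) * x j \<le> ?b * x j"
        using pos[of j] zero_le_power2[of \<delta>] by (intro mult_right_mono) linarith+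
      then show ?thesis using growth[of j] by linarith
    qed
    then have "0 \<le> (x (Suc j) - x j) * (?b * x j - x (Suc j))" using XY by simp
    then have "x (Suc j) * x (Suc j) \<le> ((1 + ?b) * x (Suc j) - ?b * x j) * x j" by (simp add: algebra_simps)
    moreover have "(1 + real i * \<delta>\<^sup>2) * x (Suc j) * x j \<le> x (Suc j) * x (Suc j)"
      using mult_right_mono[OF IH1, of "x (Suc j)"] pos[of "Suc j"] by (simp add: mult_ac)
    ultimately have "(1 + real i * \<delta>\<^sup>2) * x (Suc j) * x j \<le> ((1 + ?b) * x (Suc j) - ?b * x j) * x j" by linarith
    then have 1: "(1 + real i * \<delta>\<^sup>2) * x (Suc j) \<le> (1 + ?b) * x (Suc j) - ?b * x j"
      using pos[of j] by (simp only: mult_le_cancel_right)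
    have 2: "\<delta>\<^sup>2 * 2 * x (Suc j) \<le> \<delta>\<^sup>2 * x (j - m) * x (Suc j)"
      using two pos[of "Suc j"] by (intro mult_right_mono mult_left_mono) auto
    have "(1 + real (Suc i) * \<delta>\<^sup>2) * x (Suc j) = (1 + real i * \<delta>\<^sup>2) * x (Suc j) + \<delta>\<^sup>2 * x (Suc j)"
      by (simp add: algebra_simps)
    also have "\<dots> \<le> (1 + ?b) * x (Suc j) - ?b * x j + \<delta>\<^sup>2 * x (Suc j)" using 1 by simp
    also have "\<dots> = (2 + c * \<delta>) * x (Suc j) + \<delta>\<^sup>2 * 2 * x (Suc j) - ?b * x j" by (simp add: algebra_simps)
    also have "\<dots> \<le> (2 + c * \<delta>) * x (Suc j) + \<delta>\<^sup>2 * x (j - m) * x (Suc j) - ?b * x j" using 2 by linarith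
    also have "\<dots> = x (Suc (Suc j))" unfolding rec by (simp add: algebra_simps)
    finally have 3: "(1 + real (Suc i) * \<delta>\<^sup>2) * x (Suc j) \<le> x (Suc (Suc j))" .
    have "1 * x (Suc j) \<le> (1 + real (Suc i) * \<delta>\<^sup>2) * x (Suc j)"
      using pos[of "Suc j"] by (intro mult_right_mono) auto
    then have "M \<le> x (Suc (Suc j))" using 3 IH2[of "Suc j"] l by (simp add: j_def)
    then show ?case using 3 IH2 by (auto simp: j_def le_Suc_eq)
  qed
  have "1 + real i * \<delta>\<^sup>2 \<le> 1 + \<beta> * \<delta>" for i
  proof -
    have "(1 + real i * \<delta>\<^sup>2) * x (l + i) \<le> (1 + \<beta> * \<delta>) * x (l + i)"
      using *[of i] growth[of "l + i"] by linarith
    then show ?thesis using pos[of "l + i"] by simp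
  qed
  moreover obtain i :: nat where "\<beta> * \<delta> < real i * \<delta>\<^sup>2"
    using ex_less_of_nat_mult[of "\<delta>\<^sup>2"] delta by auto
  ultimately show False by (meson add_le_cancel_left not_le)
qed

definition D where "D k = (x (Suc k) - x k) / \<delta>"

lemma x_Suc: "x (Suc k) = x k + \<delta> * D k" using delta by (simp add: D_def)

lemma D_Suc: "D (Suc k) = D k + \<delta> * (c * D k + x (k - m) * x (Suc k) - x k)"
proof -
  have "\<delta> * D (Suc k) = \<delta> * (D k + \<delta> * (c * D k + x (k - m) * x (Suc k) - x k))"
  proof -
    have d: "\<delta> * D j = x (Suc j) - x j" for j using x_Suc[of j] by simp
    have "\<delta> * (D k + \<delta> * (c * D k + x (k - m) * x (Suc k) - x k))
        = \<delta> * D k + \<delta> * c * (\<delta> * D k) + \<delta>\<^sup>2 * (x (k - m) * x (Suc k) - x k)"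
      by (simp add: algebra_simps power2_eq_square)
    then show ?thesis unfolding d rec by (simp add: algebra_simps)
  qed
  then show ?thesis using delta by simp
qed

lemma D_upper: "D k \<le> \<beta> * x k"
proof -
  have "\<delta> * D k \<le> \<delta> * (\<beta> * x k)" using growth[of k] x_Suc[of k] by (simp add: algebra_simps)
  then show ?thesis using delta by simp
qed

text \<open>The discrete form of \<open>wave.p_lower\<close>: below \<open>- M\<^sup>2\<close>,
  \<open>D\<close> never rises again, and \<open>x\<close> would descend linearly below 0.\<close>

lemma D_lower: "- M\<^sup>2 \<le> D k"
proof (rule ccontr)
  assume n: "\<not> - M\<^sup>2 \<le> D k"
  have *: "D (k + i) \<le> D k" for i
  proof (induction i)
    case (Suc i)
    let ?j = "k + i"
    have neg: "D ?j < - M\<^sup>2" using Suc n by linarith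
    have "c * D ?j \<le> 2 * D ?j" using c2 neg zero_le_power2[of M] by (intro mult_right_mono_neg) linarith+
    moreover have "x (?j - m) * x (Suc ?j) \<le> M * M"
      using x_less_M pos by (intro mult_mono) (auto simp: less_imp_le intro: order.trans[OF _ M2])
    ultimately have "c * D ?j + x (?j - m) * x (Suc ?j) - x ?j \<le> 0"
      using neg pos[of ?j] zero_le_power2[of M] unfolding power2_eq_square by linarith
    then have "\<delta> * (c * D ?j + x (?j - m) * x (Suc ?j) - x ?j) \<le> 0"
      using delta by (intro mult_nonneg_nonpos) auto
    then show ?case using Suc D_Suc[of ?j] by simp
  qed simp
  show False
  proof (rule no_linear_descent[of "- \<delta> * D k" k x 0])
    have "D k < 0" using n zero_le_power2[of M] by linarith
    then show "0 < - \<delta> * D k" using delta by (simp add: mult_pos_neg)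
    fix j show "0 \<le> x j" using pos[of j] by simp
    assume "k \<le> j"
    then have "D j \<le> D k" using *[of "j - k"] by simp
    then show "x (Suc j) \<le> x j - - \<delta> * D k" using delta by (simp add: x_Suc)
  qed
qed

text \<open>If \<open>x\<close> stayed below \<open>1 / 2\<close>, then
  \<open>x (Suc k) \<le> 3 / 2 x k\<close> would make the reaction term at most
  \<open>- x k / 4\<close>. A nonpositive \<open>D\<close> would then drive \<open>x\<close> below
  0, so \<open>x\<close> increases from \<open>\<epsilon>\<close>; but then \<open>D - c x\<close>,
  which is bounded below, drops by a fixed amount in every step.\<close>

lemma reaches_half: "\<exists>k. 1 / 2 \<le> x k"
proof (rule ccontr)
  assume "\<not> (\<exists>k. 1 / 2 \<le> x k)"
  then have small: "x k < 1 / 2" for k by (simp add: not_le)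
  have nonlin: "x (k - m) * x (Suc k) - x k \<le> - (x k / 4)" for k
  proof -
    have "x (k - m) * x (Suc k) \<le> 1 / 2 * ((1 + 1 / 2) * x k)"
    proof (intro mult_mono)
      have "(1 + \<beta> * \<delta>) * x k \<le> (1 + 1 / 2) * x k" using delta pos[of k] by (intro mult_right_mono) auto
      then show "x (Suc k) \<le> (1 + 1 / 2) * x k" using growth[of k] by linarith
    qed (use small[of "k - m"] pos in \<open>auto simp: less_imp_le\<close>)
    then show ?thesis by simp
  qed
  have D_dec: "D (Suc k) \<le> D k - \<delta> * (x k / 4)" if "D k \<le> 0" for k
  proof -
    have "c * D k \<le> 0" using that c2 by (intro mult_nonneg_nonpos) auto
    then have "\<delta> * (c * D k + x (k - m) * x (Suc k) - x k) \<le> \<delta> * - (x k / 4)"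
      using nonlin[of k] delta by (intro mult_left_mono) auto
    then show ?thesis by (simp add: D_Suc)
  qed
  have D_pos: "0 < D k" for k
  proof (rule ccontr)
    assume "\<not> 0 < D k"
    then have k: "D k \<le> 0" by simp
    have dx: "0 < \<delta> * (x i / 4)" for i using delta pos[of i] by simp
    have neg: "D (Suc k) < 0" using D_dec[OF k] dx[of k] k by linarith
    have *: "D (Suc k + i) \<le> D (Suc k)" for i
    proof (induction i)
      case (Suc i)
      then have "D (Suc k + i) \<le> 0" using neg by linarith
      from D_dec[OF this] show ?case using Suc dx[of "Suc k + i"] by simp
    qed simp
    show False
    proof (rule no_linear_descent[of "- \<delta> * D (Suc k)" "Suc k" x 0])
      show "0 < - \<delta> * D (Suc k)" using delta neg by (simp add: mult_pos_neg)
      fix j show "0 \<le> x j" using pos[of j] by simp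
      assume "Suc k \<le> j"
      then have "D j \<le> D (Suc k)" using *[of "j - Suc k"] by simp
      then show "x (Suc j) \<le> x j - - \<delta> * D (Suc k)" using delta by (simp add: x_Suc)
    qed
  qed
  have "\<epsilon> \<le> x k" for k
  proof (induction k)
    case (Suc k)
    have "0 < \<delta> * D k" using delta D_pos by simp
    then show ?case using Suc by (simp add: x_Suc)
  qed (simp add: x0)
  show False
  proof (rule no_linear_descent[of "\<delta> * \<epsilon> / 4" 0 "\<lambda>k. D k - c * x k" "- c / 2"])
    show "0 < \<delta> * \<epsilon> / 4" using delta eps by simp
    fix k
    have "\<delta> * (x (k - m) * x (Suc k) - x k) \<le> \<delta> * - (\<epsilon> / 4)"
      using nonlin[of k] \<open>\<epsilon> \<le> x k\<close> delta by (intro mult_left_mono) auto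
    moreover have "D (Suc k) - c * x (Suc k) = D k - c * x k + \<delta> * (x (k - m) * x (Suc k) - x k)"
      unfolding D_Suc x_Suc by (simp add: algebra_simps)
    ultimately show "D (Suc k) - c * x (Suc k) \<le> D k - c * x k - \<delta> * \<epsilon> / 4" by simp
    have "c * x k \<le> c * (1 / 2)" using small[of k] c2 by (intro mult_left_mono) auto
    then show "- c / 2 \<le> D k - c * x k" using D_pos[of k] by simp
  qed
qed

end

section \<open>Passage to the limit\<close>

text \<open>The estimates that survive the limit \<open>\<delta> \<rightarrow> 0\<close>; they are quadratic in \<open>t - s\<close>, so that the
  pointwise limits are differentiable.\<close>

definition approx_wave ::
  "real \<Rightarrow> real \<Rightarrow> real \<Rightarrow> real \<Rightarrow> real \<Rightarrow> (real \<Rightarrow> real) \<Rightarrow> (real \<Rightarrow> real) \<Rightarrow> bool" where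
  "approx_wave c \<tau> C T \<delta> \<phi> p \<longleftrightarrow> 0 < \<delta> \<and> 1 / 2 \<le> \<phi> 0 \<and>
    (\<forall>t. 0 < \<phi> t \<and> \<phi> t \<le> C \<and> \<bar>p t\<bar> \<le> C) \<and>
    (\<forall>t. - T \<le> t \<and> t \<le> 0 \<longrightarrow> \<phi> t \<le> 1 / 2 + C * \<delta>) \<and>
    (\<forall>s t. - T \<le> s - \<tau> \<and> - T \<le> t \<longrightarrow>
      \<bar>\<phi> t - \<phi> s\<bar> \<le> C * (\<bar>t - s\<bar> + \<delta>) \<and>
      \<bar>p t - p s\<bar> \<le> C * (\<bar>t - s\<bar> + \<delta>) \<and>
      \<bar>\<phi> t - \<phi> s - (t - s) * p s\<bar> \<le> C * ((\<bar>t - s\<bar> + \<delta>)\<^sup>2 + \<delta> * (1 + (\<bar>t - s\<bar> + \<delta>))) \<and>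
      \<bar>p t - p s - (t - s) * (c * p s - \<phi> s * (1 - \<phi> (s - \<tau>)))\<bar>
        \<le> C * ((\<bar>t - s\<bar> + \<delta>)\<^sup>2 + \<delta> * (1 + (\<bar>t - s\<bar> + \<delta>))))"

section \<open>From the scheme to approximate waves\<close>

context discrete_wave
begin

text \<open>In turn these bound \<open>D\<close>, then \<open>F\<close> and the steps of
  \<open>D\<close>, then the steps of \<open>F\<close>. They depend on \<open>c\<close> and
  \<open>\<tau>\<close> only, so \<open>C\<close> is uniform in \<open>\<delta>\<close> and
  \<open>\<epsilon>\<close>; its summand \<open>\<beta>\<close> covers the overshoot of the level
  \<open>1 / 2\<close>.\<close>

definition L where "L = \<beta> * M + M\<^sup>2"
definition L\<^sub>2 where "L\<^sub>2 = c * L + M\<^sup>2 + M"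
definition L\<^sub>3 where "L\<^sub>3 = c * L\<^sub>2 + L * (1 + M) + M * L"
definition C where "C = M + L + L\<^sub>2 + L\<^sub>3 + 3 * M * L + \<beta>"

lemma const_nonneg: "0 \<le> L" "0 \<le> L\<^sub>2" "0 \<le> L\<^sub>3" "0 \<le> M * L"
  using M2 lam c2 by (auto simp: L_def L\<^sub>2_def L\<^sub>3_def)

lemma const_le_C: "M \<le> C" "L \<le> C" "L\<^sub>2 \<le> C" "\<beta> \<le> C" "L\<^sub>3 \<le> C" "3 * M * L + L\<^sub>2 \<le> C" "0 \<le> C"
  using const_nonneg M2 lam by (auto simp: C_def)

text \<open>The right-hand side of the limiting equation. The scheme multiplies the delayed value by
  \<open>x (Suc k)\<close> instead of \<open>x k\<close>, an error of order \<open>\<delta>\<close>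
  controlled in \<open>D_taylor_step\<close>.\<close>

definition F where "F k = c * D k - x k * (1 - x (k - m))"

lemma abs_D: "\<bar>D k\<bar> \<le> L"
proof -
  have "\<beta> * x k \<le> \<beta> * M" using x_less_M[of k] lam by (intro mult_left_mono) auto
  then have "D k \<le> \<beta> * M" using D_upper[of k] by linarith
  moreover have "0 \<le> \<beta> * M" using lam M2 by simp
  ultimately show ?thesis using D_lower[of k] zero_le_power2[of M] unfolding L_def by linarith
qed

lemma x_bounds: "0 \<le> x k" "x k \<le> M" using pos[of k] x_less_M[of k] by auto

lemma x_step: "\<bar>x (Suc k) - x k\<bar> \<le> \<delta> * L"
  using abs_D[of k] delta by (simp add: x_Suc abs_mult)

lemma xx_bounds: "0 \<le> x i * x j" "x i * x j \<le> M * M"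
  using x_bounds M2 by (auto intro!: mult_mono)

lemma abs_cD: "\<bar>c * D k\<bar> \<le> c * L"
  using abs_D[of k] c2 by (simp add: abs_mult)

lemma D_step: "\<bar>D (Suc k) - D k\<bar> \<le> \<delta> * L\<^sub>2"
proof -
  have "\<bar>c * D k + x (k - m) * x (Suc k) - x k\<bar> \<le> L\<^sub>2"
    using abs_cD[of k] xx_bounds[of "k - m" "Suc k"] x_bounds[of k]
    unfolding L\<^sub>2_def power2_eq_square by linarith
  then show ?thesis using delta by (simp add: D_Suc abs_mult)
qed

lemma abs_F: "\<bar>F k\<bar> \<le> L\<^sub>2"
  using abs_cD[of k] xx_bounds[of k "k - m"] x_bounds[of k]
  unfolding F_def L\<^sub>2_def power2_eq_square right_diff_distrib by linarith

lemma F_step: "\<bar>F (Suc k) - F k\<bar> \<le> \<delta> * L\<^sub>3"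
proof -
  \<comment> \<open>For \<open>k < m\<close> both indices are truncated to 0 and the difference
    vanishes.\<close>
  have d: "\<bar>x (Suc k - m) - x (k - m)\<bar> \<le> \<delta> * L"
    using x_step[of "k - m"] const_nonneg delta by (cases "m \<le> k") (auto simp: Suc_diff_le)
  have "\<bar>1 - x (k - m)\<bar> \<le> 1 + M" using x_bounds[of "k - m"] by linarith
  then have 1: "\<bar>(x (Suc k) - x k) * (1 - x (k - m))\<bar> \<le> \<delta> * L * (1 + M)"
    unfolding abs_mult using x_step[of k] M2 const_nonneg delta by (intro mult_mono) auto
  have 2: "\<bar>x (Suc k) * (x (Suc k - m) - x (k - m))\<bar> \<le> M * (\<delta> * L)"
    unfolding abs_mult using d x_bounds[of "Suc k"] M2 by (intro mult_mono) auto
  have "c * \<bar>D (Suc k) - D k\<bar> \<le> c * (\<delta> * L\<^sub>2)" using D_step c2 by (intro mult_left_mono) auto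
  then have 3: "\<bar>c * (D (Suc k) - D k)\<bar> \<le> c * (\<delta> * L\<^sub>2)" using c2 by (simp add: abs_mult)
  have "F (Suc k) - F k = c * (D (Suc k) - D k) - (x (Suc k) - x k) * (1 - x (k - m))
      + x (Suc k) * (x (Suc k - m) - x (k - m))" by (simp add: F_def algebra_simps)
  moreover have "\<delta> * L\<^sub>3 = c * (\<delta> * L\<^sub>2) + \<delta> * L * (1 + M) + M * (\<delta> * L)"
    by (simp add: L\<^sub>3_def algebra_simps)
  ultimately show ?thesis using 1 2 3 by linarith
qed

lemma D_taylor_step: "\<bar>D (Suc k) - D k - \<delta> * F k\<bar> \<le> \<delta> * (\<delta> * (M * L))"
proof -
  have "D (Suc k) - D k - \<delta> * F k = \<delta> * (x (k - m) * (x (Suc k) - x k))"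
    by (simp add: D_Suc F_def algebra_simps)
  moreover have "\<bar>x (k - m) * (x (Suc k) - x k)\<bar> \<le> M * (\<delta> * L)"
    unfolding abs_mult using x_step[of k] x_bounds[of "k - m"] M2 by (intro mult_mono) auto
  ultimately show ?thesis using delta by (simp add: abs_mult mult_ac)
qed

text \<open>Step functions on the grid, with the first index \<open>K\<close> at level
  \<open>1 / 2\<close> moved to time 0. The hypothesis on \<open>\<epsilon>\<close> ensures that the
  grid reaches back at least to time \<open>- T\<close>.\<close>

lemma approx:
  assumes "T \<ge> 0" "ln (1 / (2 * \<epsilon>)) \<ge> \<beta> * T"
  shows "\<exists>\<phi> p. approx_wave c \<tau> C T \<delta> \<phi> p"
proof -
  define K where "K = (LEAST k. 1 / 2 \<le> x k)"
  have K: "1 / 2 \<le> x K" "\<And>j. j < K \<Longrightarrow> x j < 1 / 2"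
    unfolding K_def using LeastI_ex[OF reaches_half] not_less_Least by (auto simp: not_le[symmetric])
  then obtain K' where K': "K = Suc K'" using x0 eps by (cases K) auto
  have xK: "x K \<le> 1 / 2 + \<beta> * \<delta>"
  proof -
    have "(1 + \<beta> * \<delta>) * x K' \<le> (1 + \<beta> * \<delta>) * (1 / 2)"
      using K(2)[of K'] K' lam delta by (intro mult_left_mono) auto
    moreover have "0 \<le> \<beta> * \<delta>" using lam delta by simp
    ultimately show ?thesis using growth[of K'] unfolding K' by (simp add: algebra_simps)
  qed
  \<comment> \<open>Growth from \<open>\<epsilon>\<close> to \<open>1 / 2\<close> at rate at most
    \<open>\<beta>\<close> takes at least the time
    \<open>ln (1 / (2 \<epsilon>)) / \<beta>\<close>.\<close>
  have TK: "T \<le> real K * \<delta>"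
  proof -
    have "1 / 2 \<le> exp (\<beta> * \<delta> * real K) * \<epsilon>" using K(1) growth_exp[of 0 K] x0 by simp
    then have "1 / (2 * \<epsilon>) \<le> exp (\<beta> * \<delta> * real K)" using eps by (simp add: field_simps)
    then have "ln (1 / (2 * \<epsilon>)) \<le> \<beta> * \<delta> * real K"
      using eps by (metis exp_gt_zero divide_pos_pos ln_exp ln_le_cancel_iff mult_pos_pos zero_less_numeral zero_less_one)
    then have "\<beta> * T \<le> \<beta> * (real K * \<delta>)" using assms by (simp add: mult_ac)
    then show ?thesis using lam by simp
  qed
  define idx where "idx t = nat (int K + \<lfloor>t / \<delta>\<rfloor>)" for t
  have idx: "real (idx t) = real K + real_of_int \<lfloor>t / \<delta>\<rfloor>" if "- T \<le> t" for t
  proof -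
    have "- real K * \<delta> \<le> t" using that TK by simp
    then have "- real K \<le> t / \<delta>" using delta by (simp add: pos_le_divide_eq)
    then have "- int K \<le> \<lfloor>t / \<delta>\<rfloor>" by (simp add: le_floor_iff)
    then show ?thesis by (simp add: idx_def)
  qed
  have fl: "\<delta> * real_of_int \<lfloor>t / \<delta>\<rfloor> \<le> t" "t - \<delta> \<le> \<delta> * real_of_int \<lfloor>t / \<delta>\<rfloor>" for t
  proof -
    have "\<delta> * real_of_int \<lfloor>t / \<delta>\<rfloor> \<le> \<delta> * (t / \<delta>)" using delta by (intro mult_left_mono) auto
    then show "\<delta> * real_of_int \<lfloor>t / \<delta>\<rfloor> \<le> t" using delta by simp
    have "t / \<delta> - 1 \<le> real_of_int \<lfloor>t / \<delta>\<rfloor>" by linarith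
    then have "\<delta> * (t / \<delta> - 1) \<le> \<delta> * real_of_int \<lfloor>t / \<delta>\<rfloor>" using delta by (intro mult_left_mono) auto
    then show "t - \<delta> \<le> \<delta> * real_of_int \<lfloor>t / \<delta>\<rfloor>" using delta by (simp add: right_diff_distrib)
  qed
  have gap: "\<bar>\<delta> * (real (idx t) - real (idx s)) - (t - s)\<bar> \<le> \<delta>" if "- T \<le> s" "- T \<le> t" for s t
  proof -
    have "\<delta> * (real (idx t) - real (idx s)) = \<delta> * real_of_int \<lfloor>t / \<delta>\<rfloor> - \<delta> * real_of_int \<lfloor>s / \<delta>\<rfloor>"
      using idx that by (simp add: right_diff_distrib)
    then show ?thesis using fl[of t] fl[of s] by linarith
  qed
  have idx0: "idx 0 = K" by (simp add: idx_def)
  have "approx_wave c \<tau> C T \<delta> (\<lambda>t. x (idx t)) (\<lambda>t. D (idx t))"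
    unfolding approx_wave_def
  proof (intro conjI allI impI)
    fix t
    show "x (idx t) \<le> C" "\<bar>D (idx t)\<bar> \<le> C"
      using x_bounds(2)[of "idx t"] abs_D[of "idx t"] const_le_C by linarith+
    assume t: "- T \<le> t \<and> t \<le> 0"
    have "\<lfloor>t / \<delta>\<rfloor> \<le> 0" using t delta by (simp add: divide_nonpos_pos)
    then have "idx t \<le> K" by (simp add: idx_def nat_le_iff)
    then have "idx t < K \<or> idx t = K" by auto
    moreover have "0 \<le> \<beta> * \<delta>" "\<beta> * \<delta> \<le> C * \<delta>" using lam const_le_C delta by auto
    ultimately show "x (idx t) \<le> 1 / 2 + C * \<delta>" using K(2)[of "idx t"] xK by force
  next
    fix s t assume st: "- T \<le> s - \<tau> \<and> - T \<le> t"
    define i where "i = idx t"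
    define j where "j = idx s"
    define N where "N = \<delta> * \<bar>real i - real j\<bar>"
    \<comment> \<open>Rounding makes the grid distance \<open>N\<close> differ from
      \<open>\<bar>t - s\<bar>\<close> by at most \<open>\<delta>\<close>, so \<open>r\<close>
      dominates both.\<close>
    define r where "r = \<bar>t - s\<bar> + \<delta>"
    have sT: "- T \<le> s" using st tau by simp
    have g: "\<bar>\<delta> * (real i - real j) - (t - s)\<bar> \<le> \<delta>" using gap sT st by (simp add: i_def j_def)
    have "N = \<bar>\<delta> * (real i - real j)\<bar>" using delta by (simp add: N_def abs_mult)
    then have N: "0 \<le> N" "N \<le> r" using g by (auto simp: r_def)
    have r0: "0 \<le> r" "\<bar>t - s\<bar> \<le> r" using delta by (auto simp: r_def)
    have lip: "\<bar>y i - y j\<bar> \<le> A * r" if "\<And>k. \<bar>y (Suc k) - y k\<bar> \<le> \<delta> * A" "A \<ge> 0" for y :: "nat \<Rightarrow> real" and A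
    proof -
      have "\<bar>y i - y j\<bar> \<le> \<delta> * A * \<bar>real i - real j\<bar>" by (rule lipschitz_of_steps) (rule that)
      also have "\<dots> = A * N" by (simp add: N_def)
      also have "\<dots> \<le> A * r" using N that by (intro mult_left_mono) auto
      finally show ?thesis .
    qed
    have Cr: "A * r \<le> C * r" if "A \<le> C" for A using that r0 by (intro mult_right_mono) auto
    show "\<bar>x (idx t) - x (idx s)\<bar> \<le> C * (\<bar>t - s\<bar> + \<delta>)"
      using lip[where y = x and A = L, OF x_step const_nonneg(1)] Cr[OF const_le_C(2)] by (simp add: i_def j_def r_def)
    show "\<bar>D (idx t) - D (idx s)\<bar> \<le> C * (\<bar>t - s\<bar> + \<delta>)"
      using lip[where y = D and A = L\<^sub>2, OF D_step const_nonneg(2)] Cr[OF const_le_C(3)] by (simp add: i_def j_def r_def)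
    have shift: "\<bar>\<delta> * (real i - real j) * G - (t - s) * G\<bar> \<le> \<delta> * A" if "\<bar>G\<bar> \<le> A" for G A
    proof -
      have "\<bar>(\<delta> * (real i - real j) - (t - s)) * G\<bar> \<le> \<delta> * A"
        unfolding abs_mult using g that delta by (intro mult_mono) auto
      then show ?thesis by (simp add: left_diff_distrib)
    qed
    have quad: "N * (\<eta> + A * N) \<le> r * \<eta> + A * r\<^sup>2" if "0 \<le> \<eta>" "0 \<le> A" for \<eta> A
    proof -
      have "N * (\<eta> + A * N) \<le> r * (\<eta> + A * r)" using N r0 that by (intro mult_mono add_mono mult_left_mono) auto
      then show ?thesis by (simp add: algebra_simps power2_eq_square)
    qed
    have "\<bar>x i - x j - \<delta> * (real i - real j) * D j\<bar> \<le> N * (0 + L\<^sub>2 * N)"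
      unfolding N_def by (rule taylor_of_steps) (use delta const_nonneg D_step in \<open>auto simp: x_Suc\<close>)
    also have "\<dots> \<le> r * 0 + L\<^sub>2 * r\<^sup>2" by (rule quad) (use const_nonneg in auto)
    finally have "\<bar>x i - x j - (t - s) * D j\<bar> \<le> L\<^sub>2 * r\<^sup>2 + \<delta> * L"
      using shift[OF abs_D, of j] by linarith
    also have "\<dots> \<le> C * r\<^sup>2 + \<delta> * (C * (1 + r))"
    proof (intro add_mono mult_right_mono mult_left_mono const_le_C)
      have "C * 1 \<le> C * (1 + r)" using r0 const_le_C by (intro mult_left_mono) auto
      then show "L \<le> C * (1 + r)" using const_le_C by linarith
    qed (use delta in auto)
    finally show "\<bar>x (idx t) - x (idx s) - (t - s) * D (idx s)\<bar>
        \<le> C * ((\<bar>t - s\<bar> + \<delta>)\<^sup>2 + \<delta> * (1 + (\<bar>t - s\<bar> + \<delta>)))"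
      by (simp add: i_def j_def r_def algebra_simps)
    have "\<bar>D i - D j - \<delta> * (real i - real j) * F j\<bar> \<le> N * (\<delta> * (M * L) + L\<^sub>3 * N)"
      unfolding N_def by (rule taylor_of_steps) (use delta const_nonneg F_step D_taylor_step in auto)
    also have "\<dots> \<le> r * (\<delta> * (M * L)) + L\<^sub>3 * r\<^sup>2" by (rule quad) (use const_nonneg delta in auto)
    finally have 1: "\<bar>D i - D j - (t - s) * F j\<bar> \<le> r * (\<delta> * (M * L)) + L\<^sub>3 * r\<^sup>2 + \<delta> * L\<^sub>2"
      using shift[OF abs_F, of j] by linarith
    \<comment> \<open>The rounded delay \<open>m \<delta>\<close> and the rounding of
      \<open>s\<close> and \<open>s - \<tau>\<close> together displace the delayed time by at most
      \<open>2 \<delta>\<close>.\<close>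
    have "\<bar>x (j - m) - x (idx (s - \<tau>))\<bar> \<le> \<delta> * L * \<bar>real (j - m) - real (idx (s - \<tau>))\<bar>"
      by (rule lipschitz_of_steps) (rule x_step)
    also have "\<dots> = L * \<bar>\<delta> * (real (j - m) - real (idx (s - \<tau>)))\<bar>" using delta by (simp add: abs_mult)
    also have "\<dots> \<le> L * (2 * \<delta>)"
    proof (intro mult_left_mono const_nonneg)
      have "real (idx (s - \<tau>)) = real K + real_of_int \<lfloor>(s - \<tau>) / \<delta>\<rfloor>" using idx st by blast
      then have e1: "\<delta> * real (idx (s - \<tau>)) = \<delta> * real K + \<delta> * real_of_int \<lfloor>(s - \<tau>) / \<delta>\<rfloor>"
        by (simp add: distrib_left)
      have e2: "\<delta> * real j = \<delta> * real K + \<delta> * real_of_int \<lfloor>s / \<delta>\<rfloor>"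
        using idx[OF sT] by (simp add: j_def distrib_left)
      \<comment> \<open>As \<open>s - \<tau> \<ge> - T\<close>, the subtraction \<open>j - m\<close>
        is not truncated and the constant history plays no part.\<close>
      have "m \<le> j"
      proof -
        have "real m * \<delta> \<le> s + real K * \<delta>" using m(1) st TK by linarith
        then have "real m - real K \<le> s / \<delta>" using delta by (simp add: pos_le_divide_eq left_diff_distrib)
        then have "int m - int K \<le> \<lfloor>s / \<delta>\<rfloor>" by (simp add: le_floor_iff)
        then show ?thesis by (simp add: j_def idx_def le_nat_iff)
      qed
      then have "\<delta> * real (j - m) = \<delta> * real j - real m * \<delta>" by (simp add: right_diff_distrib)
      then show "\<bar>\<delta> * (real (j - m) - real (idx (s - \<tau>)))\<bar> \<le> 2 * \<delta>"
        using e1 e2 fl[of s] fl[of "s - \<tau>"] m unfolding right_diff_distrib by linarith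
    qed
    finally have "\<bar>x j * (x (j - m) - x (idx (s - \<tau>)))\<bar> \<le> M * (L * (2 * \<delta>))"
      unfolding abs_mult using x_bounds[of j] M2 by (intro mult_mono) auto
    then have "\<bar>t - s\<bar> * \<bar>x j * (x (j - m) - x (idx (s - \<tau>)))\<bar> \<le> r * (M * (L * (2 * \<delta>)))"
      using r0 by (intro mult_mono) auto
    then have 2: "\<bar>(t - s) * (x j * (x (j - m) - x (idx (s - \<tau>))))\<bar> \<le> r * (M * (L * (2 * \<delta>)))"
      by (simp only: abs_mult)
    have "D i - D j - (t - s) * (c * D j - x j * (1 - x (idx (s - \<tau>))))
      = (D i - D j - (t - s) * F j) + (t - s) * (x j * (x (j - m) - x (idx (s - \<tau>))))"
      by (simp add: F_def algebra_simps)
    then have "\<bar>D i - D j - (t - s) * (c * D j - x j * (1 - x (idx (s - \<tau>))))\<bar>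
      \<le> r * (\<delta> * (M * L)) + L\<^sub>3 * r\<^sup>2 + \<delta> * L\<^sub>2 + r * (M * (L * (2 * \<delta>)))" using 1 2 by linarith
    also have "\<dots> = L\<^sub>3 * r\<^sup>2 + \<delta> * (3 * M * L * r + L\<^sub>2)" by (simp add: algebra_simps)
    also have "\<dots> \<le> C * r\<^sup>2 + \<delta> * (C * (1 + r))"
    proof (intro add_mono mult_right_mono mult_left_mono const_le_C)
      have "3 * M * L * r \<le> C * r" "L\<^sub>2 \<le> C"
        using const_le_C const_nonneg by (auto intro!: Cr)
      then show "3 * M * L * r + L\<^sub>2 \<le> C * (1 + r)" by (simp add: algebra_simps)
    qed (use delta in auto)
    finally show "\<bar>D (idx t) - D (idx s) - (t - s) * (c * D (idx s) - x (idx s) * (1 - x (idx (s - \<tau>))))\<bar>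
        \<le> C * ((\<bar>t - s\<bar> + \<delta>)\<^sup>2 + \<delta> * (1 + (\<bar>t - s\<bar> + \<delta>)))"
      by (simp add: i_def j_def r_def algebra_simps)
  qed (use delta K(1) pos idx0 in auto)
  then show ?thesis by blast
qed

end

lemma approx_wave_exists:
  assumes c2: "c \<ge> 2" and tau: "\<tau> \<ge> 0"
  shows "\<exists>C. \<forall>n::nat. \<exists>\<delta> \<phi> p. \<delta> \<le> 1 / real (Suc n) \<and> approx_wave c \<tau> C (real n) \<delta> \<phi> p"
proof (rule exI, rule allI)
  fix n :: nat
  note lam = lam_props[OF c2]
  \<comment> \<open>This gives \<open>lam2 c * \<delta> \<le> 1 / 2\<close> as well as
    \<open>\<delta> \<le> 1 / Suc n\<close>; the next choice gives
    \<open>ln (1 / (2 \<epsilon>)) = ln 2 + lam2 c * n\<close>.\<close>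
  define \<delta> where "\<delta> = 1 / real (Suc n) / (2 * lam2 c)"
  define \<epsilon> where "\<epsilon> = exp (- lam2 c * real n) / 4"
  define m where "m = nat \<lfloor>\<tau> / \<delta>\<rfloor>"
  have n1: "0 < 1 / real (Suc n)" "1 / real (Suc n) \<le> 1" by auto
  have d: "0 < \<delta>" using lam by (simp add: \<delta>_def)
  have ld: "lam2 c * \<delta> = 1 / real (Suc n) / 2" using lam by (simp add: \<delta>_def)
  have dn: "\<delta> \<le> 1 / real (Suc n)"
    unfolding \<delta>_def using lam by (simp add: divide_le_eq)
  have e: "0 < \<epsilon>" "\<epsilon> < 1 / 2"
  proof -
    have "exp (- lam2 c * real n) \<le> 1" using lam by simp
    then show "\<epsilon> < 1 / 2" unfolding \<epsilon>_def by linarith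
  qed (simp add: \<epsilon>_def)
  have m: "real m * \<delta> \<le> \<tau>" "\<tau> \<le> real m * \<delta> + \<delta>"
  proof -
    have "0 \<le> \<tau> / \<delta>" using tau d by simp
    then have rm: "real m = real_of_int \<lfloor>\<tau> / \<delta>\<rfloor>" by (simp add: m_def)
    have "real m \<le> \<tau> / \<delta>" "\<tau> / \<delta> \<le> real m + 1" unfolding rm by linarith+
    then show "real m * \<delta> \<le> \<tau>" "\<tau> \<le> real m * \<delta> + \<delta>"
      using d by (auto simp: pos_le_divide_eq pos_divide_le_eq distrib_right)
  qed
  obtain x where x: "x 0 = \<epsilon>" "\<And>k. 0 < x k" "\<And>k. x (Suc k) \<le> (1 + lam2 c * \<delta>) * x k"
    "\<And>k. x (Suc (Suc k)) = (2 + c * \<delta> + \<delta>\<^sup>2 * x (k - m)) * x (Suc k) - (1 + c * \<delta> + \<delta>\<^sup>2) * x k"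
    using shooting[OF c2 d e(1), of m] by blast
  interpret discrete_wave c \<tau> \<delta> \<epsilon> m x
    by unfold_locales (use c2 tau d dn n1 ld m e x in \<open>auto intro: order.trans\<close>)
  have "1 / (2 * \<epsilon>) = 2 * exp (lam2 c * real n)" by (simp add: \<epsilon>_def exp_minus field_simps)
  then have "ln (1 / (2 * \<epsilon>)) = ln 2 + lam2 c * real n" by (simp add: ln_mult)
  then have "lam2 c * real n \<le> ln (1 / (2 * \<epsilon>))" by simp
  then show "\<exists>\<delta> \<phi> p. \<delta> \<le> 1 / real (Suc n) \<and> approx_wave c \<tau> (discrete_wave.C c \<tau>) (real n) \<delta> \<phi> p"
    using approx[of "real n"] dn by auto
qed

text \<open>Step functions are Lipschitz only up to an error that vanishes along the sequence, which
  still suffices to carry the Cauchy property from a nearby rational to \<open>t\<close>.\<close>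

lemma equi_lipschitz_convergent:
  fixes f :: "nat \<Rightarrow> real \<Rightarrow> real"
  assumes "C \<ge> 0" and \<delta>: "\<delta> \<longlonglongrightarrow> 0"
    and lip: "\<And>s t. \<forall>\<^sub>F n in sequentially. \<bar>f n t - f n s\<bar> \<le> C * (\<bar>t - s\<bar> + \<delta> n)"
    and conv: "\<And>q. q \<in> \<rat> \<Longrightarrow> convergent (\<lambda>n. f n q)"
  shows "convergent (\<lambda>n. f n t)"
proof -
  have "Cauchy (\<lambda>n. f n t)"
  proof (rule metric_CauchyI)
    fix e :: real assume e: "e > 0"
    obtain q where q: "q \<in> \<rat>" "t < q" "q < t + e / (8 * (C + 1))"
      using Rats_dense_in_real[of t "t + e / (8 * (C + 1))"] e assms(1) by auto
    have "C * \<bar>q - t\<bar> \<le> (C + 1) * \<bar>q - t\<bar>" by (intro mult_right_mono) auto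
    also have "\<dots> < (C + 1) * (e / (8 * (C + 1)))" using q assms(1) by (intro mult_strict_left_mono) auto
    also have "\<dots> = e / 8"
    proof -
      have *: "a * (e / (8 * a)) = e / 8" if "a > 0" for a using that by simp
      show ?thesis by (rule *) (use assms(1) in simp)
    qed
    finally have "C * (\<bar>t - q\<bar> + 0) < e / 4" using e by (simp add: abs_minus_commute)
    moreover have "(\<lambda>n. C * (\<bar>t - q\<bar> + \<delta> n)) \<longlonglongrightarrow> C * (\<bar>t - q\<bar> + 0)" by (intro tendsto_intros \<delta>)
    ultimately have "\<forall>\<^sub>F n in sequentially. C * (\<bar>t - q\<bar> + \<delta> n) < e / 4" by (intro order_tendstoD(2))
    with lip[of t q] have "\<forall>\<^sub>F n in sequentially. \<bar>f n t - f n q\<bar> < e / 4" by eventually_elim linarith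
    then obtain N1 where N1: "\<And>n. n \<ge> N1 \<Longrightarrow> \<bar>f n t - f n q\<bar> < e / 4"
      by (auto simp: eventually_sequentially)
    have "Cauchy (\<lambda>n. f n q)" using conv[OF q(1)] by (simp add: Cauchy_convergent_iff)
    from metric_CauchyD[OF this, of "e / 4"] e obtain N2
      where N2: "\<And>m n. m \<ge> N2 \<Longrightarrow> n \<ge> N2 \<Longrightarrow> \<bar>f m q - f n q\<bar> < e / 4"
      by (auto simp: dist_real_def)
    have "\<bar>f m t - f n t\<bar> < e" if "m \<ge> max N1 N2" "n \<ge> max N1 N2" for m n
      using N1[of m] N1[of n] N2[of m n] that by linarith
    then show "\<exists>M. \<forall>m\<ge>M. \<forall>n\<ge>M. dist (f m t) (f n t) < e" unfolding dist_real_def by blast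
  qed
  then show ?thesis by (simp add: Cauchy_convergent_iff)
qed

lemma has_derivative_of_quadratic_bound:
  fixes f :: "real \<Rightarrow> real"
  assumes "\<And>t. \<bar>f t - f s - (t - s) * d\<bar> \<le> C * (t - s)\<^sup>2"
  shows "(f has_real_derivative d) (at s)"
  unfolding has_field_derivative_iff
proof (rule Lim_null[THEN iffD2], rule Lim_null_comparison)
  show "\<forall>\<^sub>F t in at s. norm ((f t - f s) / (t - s) - d) \<le> C * \<bar>t - s\<bar>"
  proof (rule eventually_at[THEN iffD2], intro exI[of _ 1] conjI ballI impI)
    fix t assume "t \<noteq> s \<and> dist t s < 1"
    then have ts: "t - s \<noteq> 0" by simp
    have "norm ((f t - f s) / (t - s) - d) = \<bar>f t - f s - (t - s) * d\<bar> / \<bar>t - s\<bar>"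
      using ts by (simp add: field_simps flip: abs_divide)
    also have "\<dots> \<le> C * (t - s)\<^sup>2 / \<bar>t - s\<bar>" by (intro divide_right_mono assms) simp
    also have "(t - s)\<^sup>2 = \<bar>t - s\<bar>\<^sup>2" by simp
    also have "C * \<bar>t - s\<bar>\<^sup>2 / \<bar>t - s\<bar> = C * \<bar>t - s\<bar>"
      using ts by (simp only: power2_eq_square times_divide_eq_right[symmetric]) simp
    finally show "norm ((f t - f s) / (t - s) - d) \<le> C * \<bar>t - s\<bar>" .
  qed simp
  show "((\<lambda>t. C * \<bar>t - s\<bar>) \<longlongrightarrow> 0) (at s)" by (auto intro!: tendsto_eq_intros)
qed

text \<open>A subsequence converges at all rationals, hence everywhere by the equi-Lipschitz bounds.
  The Taylor estimates become purely quadratic in the limit and yield the differential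
  equations.\<close>

lemma limit_wave_exists:
  assumes c2: "c \<ge> 2" and tau: "\<tau> \<ge> 0"
  obtains C \<phi> p where "\<And>t. (\<phi> has_real_derivative p t) (at t)"
    "\<And>t. (p has_real_derivative c * p t - \<phi> t * (1 - \<phi> (t - \<tau>))) (at t)"
    "\<And>t. 0 \<le> \<phi> t" "\<And>t. \<phi> t \<le> C" "\<And>t. \<bar>p t\<bar> \<le> C" "\<And>t. t \<le> 0 \<Longrightarrow> \<phi> t \<le> 1 / 2" "1 / 2 \<le> \<phi> 0"
proof -
  obtain C where "\<forall>n::nat. \<exists>\<delta> \<phi> p. \<delta> \<le> 1 / real (Suc n) \<and> approx_wave c \<tau> C (real n) \<delta> \<phi> p"
    using approx_wave_exists[OF assms] by blast
  then obtain \<delta> :: "nat \<Rightarrow> real" and \<Phi> P :: "nat \<Rightarrow> real \<Rightarrow> real" where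
    \<delta>: "\<And>n. \<delta> n \<le> 1 / real (Suc n)" and ap: "\<And>n. approx_wave c \<tau> C (real n) (\<delta> n) (\<Phi> n) (P n)"
    by metis
  note ap' = ap[unfolded approx_wave_def]
  have C0: "C \<ge> 0" using ap'[of 0] by (meson abs_ge_zero order_trans)
  have "norm (\<Phi> n t, P n t) \<le> 2 * C" for n t
  proof -
    have "norm (\<Phi> n t, P n t) \<le> \<bar>\<Phi> n t\<bar> + \<bar>P n t\<bar>"
      unfolding norm_Pair using sqrt_sum_squares_le_sum_abs[of "\<Phi> n t" "P n t"] by simp
    moreover have "0 < \<Phi> n t" "\<Phi> n t \<le> C" "\<bar>P n t\<bar> \<le> C" using ap'[of n] by auto
    ultimately show ?thesis by linarith
  qed
  then obtain k where k: "strict_mono (k :: nat \<Rightarrow> nat)"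
    and kl: "\<And>q. q \<in> \<rat> \<Longrightarrow> \<exists>l. (\<lambda>n. (\<Phi> (k n) q, P (k n) q)) \<longlonglongrightarrow> l"
    using function_convergent_subsequence[of "\<rat> :: real set" "\<lambda>n q. (\<Phi> n q, P n q)" "2 * C"]
      countable_rat by metis
  have kn: "n \<le> k n" for n using seq_suble[OF k] .
  define d where "d n = \<delta> (k n)" for n
  have d: "d \<longlonglongrightarrow> 0"
  proof (rule tendsto_sandwich[of "\<lambda>_. 0" _ _ "\<lambda>n. 1 / real (Suc n)"])
    show "\<forall>\<^sub>F n in sequentially. 0 \<le> d n"
      using ap' by (auto simp: d_def less_imp_le)
    have "d n \<le> 1 / real (Suc n)" for n
    proof -
      have "1 / real (Suc (k n)) \<le> 1 / real (Suc n)" using kn[of n] by (intro divide_left_mono) auto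
      then show ?thesis using \<delta>[of "k n"] by (simp add: d_def)
    qed
    then show "\<forall>\<^sub>F n in sequentially. d n \<le> 1 / real (Suc n)" by simp
    show "(\<lambda>n. 1 / real (Suc n)) \<longlonglongrightarrow> 0" using LIMSEQ_inverse_real_of_nat by (simp add: inverse_eq_divide)
  qed auto
  \<comment> \<open>As \<open>k n \<ge> n\<close>, any fixed time eventually lies in the window
    \<open>t \<ge> - k n\<close> where the estimates hold.\<close>
  have large: "\<forall>\<^sub>F n in sequentially. - real (k n) \<le> t" for t
  proof -
    obtain N :: nat where N: "- t \<le> real N" using real_arch_simple by blast
    have "- real (k n) \<le> t" if "n \<ge> N" for n using N kn[of n] that by linarith
    then show ?thesis by (auto simp: eventually_sequentially)
  qed
  have large2: "\<forall>\<^sub>F n in sequentially. - real (k n) \<le> s - \<tau> \<and> - real (k n) \<le> t" for s t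
    using large[of "s - \<tau>"] large[of t] by eventually_elim simp
  have lip\<Phi>: "\<forall>\<^sub>F n in sequentially. \<bar>\<Phi> (k n) t - \<Phi> (k n) s\<bar> \<le> C * (\<bar>t - s\<bar> + d n)" for s t
    using large2[of s t] by eventually_elim (use ap' in \<open>auto simp: d_def\<close>)
  have lipP: "\<forall>\<^sub>F n in sequentially. \<bar>P (k n) t - P (k n) s\<bar> \<le> C * (\<bar>t - s\<bar> + d n)" for s t
    using large2[of s t] by eventually_elim (use ap' in \<open>auto simp: d_def\<close>)
  have conv: "convergent (\<lambda>n. \<Phi> (k n) t)" "convergent (\<lambda>n. P (k n) t)" for t
  proof -
    have q: "convergent (\<lambda>n. \<Phi> (k n) q)" "convergent (\<lambda>n. P (k n) q)" if "q \<in> \<rat>" for q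
      using kl[OF that] unfolding convergent_def by (force dest: tendsto_fst tendsto_snd)+
    show "convergent (\<lambda>n. \<Phi> (k n) t)" "convergent (\<lambda>n. P (k n) t)"
      using equi_lipschitz_convergent[OF C0 d lip\<Phi> q(1)] equi_lipschitz_convergent[OF C0 d lipP q(2)] by auto
  qed
  define \<phi> where "\<phi> t = lim (\<lambda>n. \<Phi> (k n) t)" for t
  define p where "p t = lim (\<lambda>n. P (k n) t)" for t
  have \<phi>: "(\<lambda>n. \<Phi> (k n) t) \<longlonglongrightarrow> \<phi> t" for t using conv(1)[of t] by (simp add: convergent_LIMSEQ_iff \<phi>_def)
  have p: "(\<lambda>n. P (k n) t) \<longlonglongrightarrow> p t" for t using conv(2)[of t] by (simp add: convergent_LIMSEQ_iff p_def)
  have err: "(\<lambda>n. C * ((\<bar>t - s\<bar> + d n)\<^sup>2 + d n * (1 + (\<bar>t - s\<bar> + d n)))) \<longlonglongrightarrow> C * (t - s)\<^sup>2" for s t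
    by (rule tendsto_eq_intros d refl)+ simp
  show thesis
  proof (rule that)
    fix t
    show "(\<phi> has_real_derivative p t) (at t)"
    proof (rule has_derivative_of_quadratic_bound)
      fix s
      show "\<bar>\<phi> s - \<phi> t - (s - t) * p t\<bar> \<le> C * (s - t)\<^sup>2"
      proof (rule tendsto_le[OF trivial_limit_sequentially err])
        show "(\<lambda>n. \<bar>\<Phi> (k n) s - \<Phi> (k n) t - (s - t) * P (k n) t\<bar>) \<longlonglongrightarrow> \<bar>\<phi> s - \<phi> t - (s - t) * p t\<bar>"
          by (intro tendsto_intros \<phi> p)
        show "\<forall>\<^sub>F n in sequentially. \<bar>\<Phi> (k n) s - \<Phi> (k n) t - (s - t) * P (k n) t\<bar>
            \<le> C * ((\<bar>s - t\<bar> + d n)\<^sup>2 + d n * (1 + (\<bar>s - t\<bar> + d n)))"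
          using large2[of t s] by eventually_elim (use ap' in \<open>auto simp: d_def\<close>)
      qed
    qed
    show "(p has_real_derivative c * p t - \<phi> t * (1 - \<phi> (t - \<tau>))) (at t)"
    proof (rule has_derivative_of_quadratic_bound)
      fix s
      show "\<bar>p s - p t - (s - t) * (c * p t - \<phi> t * (1 - \<phi> (t - \<tau>)))\<bar> \<le> C * (s - t)\<^sup>2"
      proof (rule tendsto_le[OF trivial_limit_sequentially err])
        show "(\<lambda>n. \<bar>P (k n) s - P (k n) t - (s - t) * (c * P (k n) t - \<Phi> (k n) t * (1 - \<Phi> (k n) (t - \<tau>)))\<bar>)
            \<longlonglongrightarrow> \<bar>p s - p t - (s - t) * (c * p t - \<phi> t * (1 - \<phi> (t - \<tau>)))\<bar>"
          by (intro tendsto_intros \<phi> p)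
        show "\<forall>\<^sub>F n in sequentially.
            \<bar>P (k n) s - P (k n) t - (s - t) * (c * P (k n) t - \<Phi> (k n) t * (1 - \<Phi> (k n) (t - \<tau>)))\<bar>
            \<le> C * ((\<bar>s - t\<bar> + d n)\<^sup>2 + d n * (1 + (\<bar>s - t\<bar> + d n)))"
          using large2[of t s] by eventually_elim (use ap' in \<open>auto simp: d_def\<close>)
      qed
    qed
    show "0 \<le> \<phi> t"
      by (rule tendsto_lowerbound[OF \<phi>]) (use ap' in \<open>auto simp: less_imp_le\<close>)
    show "\<phi> t \<le> C" by (rule tendsto_upperbound[OF \<phi>]) (use ap' in auto)
    show "\<bar>p t\<bar> \<le> C" by (rule tendsto_upperbound[OF tendsto_rabs[OF p]]) (use ap' in auto)
    show "1 / 2 \<le> \<phi> 0" by (rule tendsto_lowerbound[OF \<phi>]) (use ap' in auto)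
    assume t: "t \<le> 0"
    have "(\<lambda>n. 1 / 2 + C * d n) \<longlonglongrightarrow> 1 / 2 + C * 0" by (intro tendsto_intros d)
    moreover have "\<forall>\<^sub>F n in sequentially. \<Phi> (k n) t \<le> 1 / 2 + C * d n"
      using large[of t] by eventually_elim (use ap' t in \<open>auto simp: d_def\<close>)
    ultimately have "\<phi> t \<le> 1 / 2 + C * 0"
      using tendsto_le[OF trivial_limit_sequentially _ \<phi>[of t]] by blast
    then show "\<phi> t \<le> 1 / 2" by simp
  qed
qed

text \<open>The limit is only known to be nonnegative and at most \<open>1 / 2\<close> on the left
  half-line; strict positivity and the limit at -\<infinity> follow from the equation and from
  \<open>\<phi> 0 \<ge> 1 / 2\<close>.\<close>

lemma wave_exists:
  assumes c2: "c \<ge> 2" and tau: "\<tau> \<ge> 0"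
  shows "\<exists>B \<phi> p. wave c \<tau> B \<phi> p"
proof -
  obtain C \<phi> p where d_phi: "\<And>t. (\<phi> has_real_derivative p t) (at t)"
    and d_p: "\<And>t. (p has_real_derivative c * p t - \<phi> t * (1 - \<phi> (t - \<tau>))) (at t)"
    and nn: "\<And>t. 0 \<le> \<phi> t" and bdd: "\<And>t. \<phi> t \<le> C" and p_bdd: "\<And>t. \<bar>p t\<bar> \<le> C"
    and half: "\<And>t. t \<le> 0 \<Longrightarrow> \<phi> t \<le> 1 / 2" and phi0: "1 / 2 \<le> \<phi> 0"
    using limit_wave_exists[OF assms] by metis
  have C0: "0 \<le> C" using p_bdd[of 0] by linarith
  have pos: "0 < \<phi> t" for t
  proof (rule ccontr)
    assume "\<not> 0 < \<phi> t"
    then have zero: "\<phi> t = 0" using nn[of t] by simp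
    have "p t = 0" by (rule DERIV_local_min[OF d_phi, of 1]) (use nn zero in auto)
    \<comment> \<open>With \<open>\<phi>(s - \<tau>)\<close> regarded as a bounded coefficient the
      equation is linear, so \<open>\<bar>E'\<bar> \<le> K E\<close> and a zero of \<open>E\<close>
      spreads in both directions, up to time 0.\<close>
    define E where "E s = (\<phi> s)\<^sup>2 + (p s)\<^sup>2" for s
    define E' where "E' s = 2 * \<phi> s * p s + 2 * p s * (c * p s - \<phi> s * (1 - \<phi> (s - \<tau>)))" for s
    define K where "K = 2 + 2 * c + C"
    have d_E: "(E has_real_derivative E' s) (at s)" for s
      unfolding E_def [abs_def] E'_def by (rule derivative_eq_intros d_phi d_p refl)+ (simp add: algebra_simps)
    have E': "\<bar>E' s\<bar> \<le> K * E s" for s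
    proof -
      have y: "2 * \<bar>\<phi> s * p s\<bar> \<le> E s"
        using sum_squares_bound[of "\<bar>\<phi> s\<bar>" "\<bar>p s\<bar>"] by (simp add: E_def abs_mult)
      have "\<bar>1 - (1 - \<phi> (s - \<tau>))\<bar> \<le> C" using nn[of "s - \<tau>"] bdd[of "s - \<tau>"] by simp
      then have "2 * \<bar>\<phi> s * p s\<bar> * \<bar>1 - (1 - \<phi> (s - \<tau>))\<bar> \<le> E s * C" using y by (intro mult_mono) (auto simp: E_def)
      then have 1: "\<bar>2 * (\<phi> s * p s) * (1 - (1 - \<phi> (s - \<tau>)))\<bar> \<le> E s * C" by (simp only: abs_mult)
      have 2: "2 * c * (p s)\<^sup>2 \<le> 2 * c * E s" using c2 by (intro mult_left_mono) (auto simp: E_def)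
      have 3: "0 \<le> 2 * c * (p s)\<^sup>2" "0 \<le> E s" using c2 by (auto simp: E_def)
      have "E' s = 2 * (\<phi> s * p s) * (1 - (1 - \<phi> (s - \<tau>))) + 2 * c * (p s)\<^sup>2"
        by (simp add: E'_def power2_eq_square algebra_simps)
      moreover have "K * E s = E s * C + 2 * c * E s + 2 * E s" by (simp add: K_def algebra_simps)
      ultimately show ?thesis using 1 2 3 by linarith
    qed
    have E1: "0 \<le> E' s + K * E s" and E2: "E' s + - K * E s \<le> 0" for s
      using E'[of s] by auto
    have dexp: "((\<lambda>s. exp (a * s) * E s) has_real_derivative exp (a * s) * (E' s + a * E s)) (at s)" for a s
      by (rule derivative_eq_intros d_E refl)+ (simp add: algebra_simps)
    have Et: "E t = 0" using zero \<open>p t = 0\<close> by (simp add: E_def)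
    have "E 0 \<le> 0"
    proof (cases "0 \<le> t")
      case True
      have "exp (K * 0) * E 0 \<le> exp (K * t) * E t"
        by (rule deriv_nonneg_mono[OF True dexp]) (rule mult_nonneg_nonneg[OF exp_ge_zero E1])
      then show ?thesis using Et by simp
    next
      case False
      have "exp (- K * 0) * E 0 \<le> exp (- K * t) * E t"
        by (rule deriv_nonpos_antimono[OF _ dexp])
          (use False in simp, rule mult_nonneg_nonpos[OF exp_ge_zero E2])
      then show ?thesis using Et by simp
    qed
    moreover have "0 < (\<phi> 0)\<^sup>2" using phi0 by simp
    ultimately show False using zero_le_power2[of "p 0"] by (simp add: E_def)
  qed
  have react: "\<phi> t / 2 \<le> \<phi> t * (1 - \<phi> (t - \<tau>))" if "t \<le> 0" for t
    using mult_left_mono[OF half[of "t - \<tau>"], of "\<phi> t"] that tau nn[of t] by (simp add: algebra_simps)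
  \<comment> \<open>If \<open>p s \<le> 0\<close>, the decrease of \<open>exp (- c t) p\<close>
    keeps \<open>p\<close> negative up to time 0, and \<open>\<phi> 0\<close> would fall below
    \<open>\<phi> (s / 2) \<le> 1 / 2\<close>.\<close>
  have p_pos: "0 < p s" if s: "s < 0" for s
  proof (rule ccontr)
    assume n: "\<not> 0 < p s"
    have "p t < 0" if t: "s < t" "t \<le> 0" for t
    proof -
      have "exp (- c * t) * p t < exp (- c * s) * p s"
      proof (rule DERIV_neg_imp_decreasing[OF t(1)], intro exI conjI)
        fix y assume y: "s \<le> y" "y \<le> t"
        show "((\<lambda>y. exp (- c * y) * p y) has_real_derivative exp (- c * y) * - (\<phi> y * (1 - \<phi> (y - \<tau>)))) (at y)"
          by (rule derivative_eq_intros d_p refl)+ (simp add: algebra_simps)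
        show "exp (- c * y) * - (\<phi> y * (1 - \<phi> (y - \<tau>))) < 0"
          using react[of y] pos[of y] y t by (intro mult_pos_neg) auto
      qed
      also have "\<dots> \<le> 0" using n by (intro mult_nonneg_nonpos) auto
      finally show ?thesis by (simp add: mult_less_0_iff)
    qed
    then have neg: "\<exists>y. (\<phi> has_real_derivative y) (at t) \<and> y < 0" if "s < t" "t \<le> 0" for t
      using d_phi[of t] that by blast
    have "\<phi> 0 < \<phi> (s / 2)"
      by (rule DERIV_neg_imp_decreasing[OF _ neg]) (use s in auto)
    then show False using half[of "s / 2"] phi0 s by simp
  qed
  \<comment> \<open>By monotonicity, arbitrarily small values suffice. If
    \<open>\<phi> \<ge> e\<close> on the left half-line, \<open>p - c \<phi>\<close> would decrease
    there at rate at least \<open>e / 2\<close>, yet it is bounded.\<close>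
  have lim: "(\<phi> \<longlongrightarrow> 0) at_bot"
  proof (rule order_tendstoI)
    fix e :: real assume e: "0 < e"
    have "\<exists>t\<le>0. \<phi> t < e"
    proof (rule ccontr)
      assume "\<not> (\<exists>t\<le>0. \<phi> t < e)"
      then have ge: "e \<le> \<phi> t" if "t \<le> 0" for t using that by (auto simp: not_less)
      \<comment> \<open>So early that a decrease at rate \<open>e / 2\<close> up to time 0 amounts
        to \<open>2 C + c C + 1\<close>, more than the bounds on \<open>p\<close> and
        \<open>\<phi>\<close> allow.\<close>
      define t where "t = - 2 * (2 * C + c * C + 1) / e"
      have "0 \<le> 2 * C + c * C + 1" using C0 c2 by simp
      then have t: "t \<le> 0" unfolding t_def using e by (intro divide_nonpos_pos) auto
      have "(p 0 - c * \<phi> 0) - (p t - c * \<phi> t) \<le> - (e / 2) * 0 - - (e / 2) * t"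
      proof (rule deriv_le_diff[OF t])
        fix y :: real assume y: "y \<le> 0"
        show "((\<lambda>y. p y - c * \<phi> y) has_real_derivative - (\<phi> y * (1 - \<phi> (y - \<tau>)))) (at y)"
          by (rule derivative_eq_intros d_p d_phi refl)+ simp
        show "- (\<phi> y * (1 - \<phi> (y - \<tau>))) \<le> - (e / 2)" using react[OF y] ge[OF y] by linarith
      qed (auto intro!: derivative_eq_intros)
      also have "- (e / 2) * 0 - - (e / 2) * t = - (2 * C + c * C + 1)" using e by (simp add: t_def)
      finally have "2 * C + c * C + 1 \<le> p t - p 0 - c * \<phi> t + c * \<phi> 0" by linarith
      moreover have "c * \<phi> 0 \<le> c * C" "0 \<le> c * \<phi> t" using bdd[of 0] nn[of t] c2 by auto
      ultimately show False using p_bdd[of t] p_bdd[of 0] by linarith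
    qed
    then obtain s where s: "s \<le> 0" "\<phi> s < e" by blast
    \<comment> \<open>\<open>p_pos\<close> excludes time 0, hence the retreat to
      \<open>s - 1\<close>.\<close>
    have "\<phi> t < e" if t: "t \<le> s - 1" for t
    proof -
      have "\<phi> t \<le> \<phi> (s - 1)" "\<phi> (s - 1) \<le> \<phi> s"
      proof -
        show "\<phi> t \<le> \<phi> (s - 1)"
          by (rule deriv_nonneg_mono[OF t d_phi]) (use p_pos s in \<open>auto simp: less_imp_le\<close>)
        show "\<phi> (s - 1) \<le> \<phi> s"
          by (rule DERIV_nonneg_imp_increasing_open[of "s - 1" s \<phi>])
            (use p_pos s d_phi DERIV_isCont[OF d_phi] in
              \<open>auto intro!: continuous_at_imp_continuous_on exI simp: less_imp_le\<close>)
      qed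
      then show ?thesis using s by linarith
    qed
    then show "\<forall>\<^sub>F t in at_bot. \<phi> t < e" by (auto simp: eventually_at_bot_linorder)
  qed (use nn in \<open>auto intro!: always_eventually intro: less_le_trans\<close>)
  have "wave c \<tau> C \<phi> p" by unfold_locales (use c2 tau d_phi d_p pos bdd lim in auto)
  then show ?thesis by blast
qed

section \<open>Semi-wavefronts\<close>

lemma semi_wavefront_profile_iff_wave:
  assumes "c \<ge> 2" "h \<ge> 0"
  shows "semi_wavefront_profile h c \<phi> \<longleftrightarrow> (\<exists>B p. wave c (c * h) B \<phi> p)"
proof
  assume "semi_wavefront_profile h c \<phi>"
  then obtain p q where d: "\<And>s. (\<phi> has_real_derivative p s) (at s)"
      "\<And>s. (p has_real_derivative q s) (at s)"
    and eq: "\<And>s. q s - c * p s + \<phi> s * (1 - \<phi> (s - c * h)) = 0"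
    and "\<And>s. \<phi> s > 0" "bounded (range \<phi>)" "(\<phi> \<longlongrightarrow> 0) at_bot"
    unfolding semi_wavefront_profile_def kpp_fisher_solution_travelling_iff by blast
  moreover have "q s = c * p s - \<phi> s * (1 - \<phi> (s - c * h))" for s using eq[of s] by simp
  moreover obtain B where "\<And>s. \<phi> s \<le> B"
    using \<open>bounded (range \<phi>)\<close> by (force simp: bounded_iff dest: abs_le_D1)
  ultimately have "wave c (c * h) B \<phi> p"
    using assms by unfold_locales auto
  then show "\<exists>B p. wave c (c * h) B \<phi> p" by blast
next
  assume "\<exists>B p. wave c (c * h) B \<phi> p"
  then obtain B p where "wave c (c * h) B \<phi> p" by blast
  then interpret wave c "c * h" B \<phi> p .
  have "bounded (range \<phi>)"
    unfolding bounded_iff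
  proof (intro exI[of _ B] ballI)
    fix y assume "y \<in> range \<phi>"
    then obtain t where "y = \<phi> t" by blast
    then show "norm y \<le> B" using pos[of t] bdd[of t] by simp
  qed
  moreover have "continuous_on UNIV (\<lambda>s. c * p s - \<phi> s * (1 - \<phi> (s - c * h)))"
  proof -
    have "continuous_on UNIV \<phi>" "continuous_on UNIV p"
      using DERIV_isCont[OF d_phi] DERIV_isCont[OF d_p] by (auto intro: continuous_at_imp_continuous_on)
    then show ?thesis by (auto intro!: continuous_intros intro: continuous_on_compose2)
  qed
  moreover have "kpp_fisher_solution h (\<lambda>t x. \<phi> (x + c * t))"
    unfolding kpp_fisher_solution_travelling_iff
    by (rule exI[of _ p], rule exI[of _ "\<lambda>s. c * p s - \<phi> s * (1 - \<phi> (s - c * h))"])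
      (use d_phi d_p calculation in auto)
  ultimately show "semi_wavefront_profile h c \<phi>"
    using pos lim0 by (simp add: semi_wavefront_profile_def)
qed

theorem corollary2:
  fixes c h :: real
  assumes "c \<ge> 2" and "h \<ge> 0"
  shows "(\<exists>\<phi>. semi_wavefront_profile h c \<phi>) \<and>
    (\<forall>\<phi> \<psi>. semi_wavefront_profile h c \<phi> \<and> semi_wavefront_profile h c \<psi> \<longrightarrow>
      (\<exists>t'. \<forall>t. \<phi> (t + t') = \<psi> t))"
proof (intro conjI allI impI)
  have "c * h \<ge> 0" using assms by simp
  from wave_exists[OF assms(1) this] show "\<exists>\<phi>. semi_wavefront_profile h c \<phi>"
    by (auto simp: semi_wavefront_profile_iff_wave[OF assms])
next
  fix \<phi> \<psi> assume "semi_wavefront_profile h c \<phi> \<and> semi_wavefront_profile h c \<psi>"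
  then obtain B p B' r where "wave c (c * h) B \<phi> p" "wave c (c * h) B' \<psi> r"
    by (auto simp: semi_wavefront_profile_iff_wave[OF assms])
  \<comment> \<open>The comparison of two profiles works with one common bound.\<close>
  then have "wave c (c * h) (max B B') \<phi> p" "wave c (c * h) (max B B') \<psi> r"
    by (auto intro: wave.weaken)
  then show "\<exists>t'. \<forall>t. \<phi> (t + t') = \<psi> t" by (rule wave_unique)
qed

end
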